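(* For every $\eta>0$ there is $C=C(\eta)>0$ such that the following holds. Let $\varepsilon>0$, $A>0$, $1/2+\eta\leq p\leq 1$, let $n$ be a positive integer and let $f\colon\{0,1\}^n\to\{0,1\}$ be a function such that $\mathbb{E}_{x}[s_f(x)^{p}]\leq A$. Then $f$ is $\varepsilon$-close to a $J$-junta, where $J=2^{C(A/\varepsilon)^{1/p}}$.
   Context: Here $x$ is uniformly distributed over $\{0,1\}^n$. The sensitivity $s_f(x)$ of $f$ at $x$ is the number of coordinates $i\in[n]=\{1,\dots,n\}$ such that $f(x\oplus e_i)\neq f(x)$, where $x\oplus e_i$ is $x$ with its $i$th bit flipped. For a real number $j$, a function $g\colon\{0,1\}^n\to\{0,1\}$ is a $j$-junta if there exist a set $S\subseteq[n]$ of size at most $j$ and a function $h\colon\{0,1\}^S\to\{0,1\}$ such that $g(x)=h(x_S)$ for all $x\in\{0,1\}^n$, where $x_S$ is the restriction of $x$ to the coordinates in $S$. A function $f\colon\{0,1\}^n\to\{0,1\}$ is $\varepsilon$-close to a $j$-junta if there is a $j$-junta $g\colon\{0,1\}^n\to\{0,1\}$ with $\Pr_x[f(x)\neq g(x)]\leq\varepsilon$. *)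

theory Defs
  imports "HOL-Probability.Probability"
begin

text \<open>
  The dimension \<open>n\<close> is quantified below the constant \<open>C\<close>, so it cannot be a type.
  Points of the cube are extensional functions on \<open>{1..n}\<close>, with \<open>bool\<close> playing the role of
  \<open>{0,1}\<close>. A Boolean function on the cube is a total function \<open>(nat \<Rightarrow> bool) \<Rightarrow> bool\<close>;
  only its values on \<open>cube n\<close> matter for the notions below.
\<close>

definition cube :: "nat \<Rightarrow> (nat \<Rightarrow> bool) set" where
  "cube n = {1..n} \<rightarrow>\<^sub>E UNIV"

lemma finite_cube: "finite (cube n)"
  unfolding cube_def by (intro finite_PiE) auto

lemma cube_nonempty: "cube n \<noteq> {}"
  unfolding cube_def by (simp add: PiE_eq_empty_iff)

definition uniform_cube :: "nat \<Rightarrow> (nat \<Rightarrow> bool) pmf" where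
  "uniform_cube n = pmf_of_set (cube n)"

lemma set_pmf_uniform_cube: "set_pmf (uniform_cube n) = cube n"
  unfolding uniform_cube_def by (rule set_pmf_of_set[OF cube_nonempty finite_cube])

definition flip_bit :: "(nat \<Rightarrow> bool) \<Rightarrow> nat \<Rightarrow> nat \<Rightarrow> bool" where
  "flip_bit x i = x(i := \<not> x i)"

lemma flip_bit_in_cube: "x \<in> cube n \<Longrightarrow> i \<in> {1..n} \<Longrightarrow> flip_bit x i \<in> cube n"
  unfolding cube_def flip_bit_def by (auto simp: PiE_iff extensional_def)

definition sensitivity :: "nat \<Rightarrow> ((nat \<Rightarrow> bool) \<Rightarrow> bool) \<Rightarrow> (nat \<Rightarrow> bool) \<Rightarrow> nat" where
  "sensitivity n f x = card {i \<in> {1..n}. f (flip_bit x i) \<noteq> f x}"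

text \<open>The restriction \<open>restrict x S\<close> is an extensional function on \<open>S\<close>, i.e. a point of
  \<open>{0,1}\<^sup>S\<close>; \<open>h\<close> is only evaluated at such points.\<close>

definition is_junta :: "nat \<Rightarrow> real \<Rightarrow> ((nat \<Rightarrow> bool) \<Rightarrow> bool) \<Rightarrow> bool" where
  "is_junta n j g \<longleftrightarrow>
     (\<exists>S h. S \<subseteq> {1..n} \<and> real (card S) \<le> j \<and> (\<forall>x\<in>cube n. g x = h (restrict x S)))"

definition close_to_junta :: "nat \<Rightarrow> real \<Rightarrow> real \<Rightarrow> ((nat \<Rightarrow> bool) \<Rightarrow> bool) \<Rightarrow> bool" where
  "close_to_junta n \<epsilon> j f \<longleftrightarrow>
     (\<exists>g. is_junta n j g \<and> measure_pmf.prob (uniform_cube n) {x. f x \<noteq> g x} \<le> \<epsilon>)"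

end

theory Submission
  imports Defs
begin

text \<open>
  Take \<open>f\<close> with values in \<open>{-1, 1}\<close>. By convexity of the norm, the expectation of \<open>sqrt s\<^sub>f\<close> dominates the
  level-1 Fourier weight. Applied after restricting to a \<open>\<delta>\<close>-random set of live coordinates, which
  shrinks the \<open>p\<close>-th moment of the sensitivity by a factor \<open>\<delta> powr p\<close>, this bounds the \<open>\<delta>\<close>-derivative
  of the noise sensitivity; integrating, the noise sensitivity is at most \<open>A * \<delta> powr p / p\<close>, so the
  Fourier weight above level \<open>d\<close> is \<open>O(A * d powr -p)\<close>. The same convexity in the norm with
  exponent \<open>1/p\<close> bounds the sum of the \<open>1/p\<close>-th powers of the influences by \<open>A powr (1/p)\<close>. Since
  \<open>1/p\<close> is bounded away from \<open>2\<close>, hypercontractivity with exponent close to \<open>1\<close> shows that the coordinates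
  of influence below \<open>exp (- O(d))\<close> carry little Fourier weight up to level \<open>d\<close>. Taking \<open>d\<close> of order
  \<open>(A/\<epsilon>) powr (1/p)\<close> and rounding the conditional expectation on the remaining coordinates gives the junta.
\<close>

section \<open>Fourier analysis on subsets of a finite set\<close>

text \<open>Young's inequality is summed over the terms normalised by the totals of \<open>u\<close>
  and \<open>v\<close>; its right-hand sides add up to 1. If a total is zero, every term vanishes
  because \<open>0 powr _ = 0\<close>.\<close>

lemma Holder_sum_powr:
  fixes u v :: "'a \<Rightarrow> real"
  assumes "finite X" and "0 < \<theta>" and "\<theta> < 1"
    and u: "\<And>x. x \<in> X \<Longrightarrow> 0 \<le> u x" and v: "\<And>x. x \<in> X \<Longrightarrow> 0 \<le> v x"
  shows "(\<Sum>x\<in>X. u x powr \<theta> * v x powr (1 - \<theta>)) \<le> sum u X powr \<theta> * sum v X powr (1 - \<theta>)"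
proof (cases "sum u X = 0 \<or> sum v X = 0")
  case True
  then have "(\<forall>x\<in>X. u x = 0) \<or> (\<forall>x\<in>X. v x = 0)"
    using assms sum_nonneg_eq_0_iff by metis
  then have "(\<Sum>x\<in>X. u x powr \<theta> * v x powr (1 - \<theta>)) = 0"
    by (intro sum.neutral) auto
  then show ?thesis by simp
next
  case False
  define U V where "U = sum u X" and "V = sum v X"
  have UV: "U > 0" "V > 0"
    using False u v sum_nonneg[of X u] sum_nonneg[of X v] unfolding U_def V_def by force+
  have "u x powr \<theta> * v x powr (1 - \<theta>) \<le> U powr \<theta> * V powr (1 - \<theta>) * (\<theta> * (u x / U) + (1 - \<theta>) * (v x / V))"
    if x: "x \<in> X" for x
  proof (cases "u x = 0 \<or> v x = 0")
    case True
    then show ?thesis using UV u[OF x] v[OF x] assms by auto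
  next
    case False
    then have pos: "u x > 0" "v x > 0" using u[OF x] v[OF x] by auto
    have "(u x / U) powr \<theta> * (v x / V) powr (1 - \<theta>) \<le> \<theta> * (u x / U) + (1 - \<theta>) * (v x / V)"
      using Youngs_inequality_0[of \<theta> "1 - \<theta>" "u x / U" "v x / V"] pos UV assms by simp
    then have "U powr \<theta> * V powr (1 - \<theta>) * ((u x / U) powr \<theta> * (v x / V) powr (1 - \<theta>))
        \<le> U powr \<theta> * V powr (1 - \<theta>) * (\<theta> * (u x / U) + (1 - \<theta>) * (v x / V))"
      by (intro mult_left_mono) auto
    moreover have "U powr \<theta> * V powr (1 - \<theta>) * ((u x / U) powr \<theta> * (v x / V) powr (1 - \<theta>))
        = u x powr \<theta> * v x powr (1 - \<theta>)"
      using pos UV by (simp add: powr_divide)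
    ultimately show ?thesis by simp
  qed
  then have "(\<Sum>x\<in>X. u x powr \<theta> * v x powr (1 - \<theta>))
      \<le> (\<Sum>x\<in>X. U powr \<theta> * V powr (1 - \<theta>) * (\<theta> * (u x / U) + (1 - \<theta>) * (v x / V)))"
    by (rule sum_mono)
  also have "\<dots> = U powr \<theta> * V powr (1 - \<theta>) * (\<theta> * (sum u X / U) + (1 - \<theta>) * (sum v X / V))"
    by (simp only: sum.distrib sum_distrib_left[symmetric] sum_divide_distrib[symmetric])
  also have "\<dots> = U powr \<theta> * V powr (1 - \<theta>)"
    using UV by (simp add: U_def V_def)
  finally show ?thesis unfolding U_def V_def .
qed

text \<open>Points of the cube \<open>{0,1}\<^sup>N\<close> are encoded as subsets of \<open>N\<close>; \<open>chi S\<close> and \<open>coef N f S\<close> are the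
  Fourier character and coefficient, so that flipping bit \<open>i\<close> is \<open>sym_diff T {i}\<close>.\<close>

definition avg :: "'a set \<Rightarrow> ('a set \<Rightarrow> real) \<Rightarrow> real" where
  "avg N f = (\<Sum>T\<in>Pow N. f T) / 2 ^ card N"

definition chi :: "'a set \<Rightarrow> 'a set \<Rightarrow> real" where
  "chi S T = (- 1) ^ card (S \<inter> T)"

definition coef :: "'a set \<Rightarrow> ('a set \<Rightarrow> real) \<Rightarrow> 'a set \<Rightarrow> real" where
  "coef N f S = avg N (\<lambda>T. f T * chi S T)"

lemma sum_Pow_insert:
  fixes g :: "'a set \<Rightarrow> 'b::comm_monoid_add"
  assumes "finite N" and "a \<notin> N"
  shows "(\<Sum>T\<in>Pow (insert a N). g T) = (\<Sum>T\<in>Pow N. g T) + (\<Sum>T\<in>Pow N. g (insert a T))"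
proof -
  have "inj_on (insert a) (Pow N)"
    using assms(2) by (auto simp: inj_on_def dest: insert_ident)
  then have "sum g (insert a ` Pow N) = (\<Sum>T\<in>Pow N. g (insert a T))"
    by (simp add: sum.reindex)
  moreover have "Pow N \<inter> insert a ` Pow N = {}" using assms(2) by auto
  ultimately show ?thesis
    using assms(1) by (simp add: Pow_insert sum.union_disjoint)
qed

lemma sum_Pow_Un:
  fixes g :: "'a set \<Rightarrow> 'b::comm_monoid_add"
  assumes "I \<inter> K = {}"
  shows "(\<Sum>T\<in>Pow (I \<union> K). g T) = (\<Sum>T2\<in>Pow K. \<Sum>T1\<in>Pow I. g (T1 \<union> T2))"
proof -
  have "(\<Sum>T2\<in>Pow K. \<Sum>T1\<in>Pow I. g (T1 \<union> T2)) = (\<Sum>(T2, T1)\<in>Pow K \<times> Pow I. g (T1 \<union> T2))"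
    by (simp add: sum.cartesian_product)
  also have "\<dots> = (\<Sum>T\<in>Pow (I \<union> K). g T)"
    by (rule sum.reindex_bij_witness[of _ "\<lambda>T. (T \<inter> K, T \<inter> I)" "\<lambda>(T2, T1). T1 \<union> T2"])
       (use assms in auto)
  finally show ?thesis by simp
qed

lemma avg_empty [simp]: "avg {} f = f {}"
  by (simp add: avg_def)

lemma avg_insert:
  assumes "finite N" and "a \<notin> N"
  shows "avg (insert a N) f = (avg N f + avg N (\<lambda>T. f (insert a T))) / 2"
  using assms by (simp add: avg_def sum_Pow_insert field_simps)

lemma avg_Un:
  assumes "finite I" and "finite K" and "I \<inter> K = {}"
  shows "avg (I \<union> K) f = avg K (\<lambda>T2. avg I (\<lambda>T1. f (T1 \<union> T2)))"
  using assms by (simp add: avg_def sum_Pow_Un card_Un_disjoint power_add sum_divide_distrib)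

lemma avg_add: "avg N (\<lambda>T. f T + g T) = avg N f + avg N g"
  by (simp add: avg_def sum.distrib add_divide_distrib)

lemma avg_diff: "avg N (\<lambda>T. f T - g T) = avg N f - avg N g"
  by (simp add: avg_def sum_subtractf diff_divide_distrib)

lemma avg_minus: "avg N (\<lambda>T. - f T) = - avg N f"
  by (simp add: avg_def sum_negf)

lemma avg_mult_left: "avg N (\<lambda>T. c * f T) = c * avg N f"
  by (simp add: avg_def sum_distrib_left)

lemma avg_mult_right: "avg N (\<lambda>T. f T * c) = avg N f * c"
  by (simp add: avg_def sum_distrib_right)

lemma avg_divide: "avg N (\<lambda>T. f T / c) = avg N f / c"
  using avg_mult_right[of N f "inverse c"] by (simp add: divide_inverse)

lemma avg_sum: "avg N (\<lambda>T. \<Sum>i\<in>A. f i T) = (\<Sum>i\<in>A. avg N (f i))"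
  unfolding avg_def by (subst sum.swap) (simp add: sum_divide_distrib)

lemma avg_const: "finite N \<Longrightarrow> avg N (\<lambda>T. c) = c"
  by (simp add: avg_def card_Pow)

lemma avg_cong: "(\<And>T. T \<subseteq> N \<Longrightarrow> f T = g T) \<Longrightarrow> avg N f = avg N g"
  by (auto simp: avg_def intro!: sum.cong)

lemma avg_mono: "(\<And>T. T \<subseteq> N \<Longrightarrow> f T \<le> g T) \<Longrightarrow> avg N f \<le> avg N g"
  by (auto simp: avg_def intro!: sum_mono divide_right_mono)

lemma avg_nonneg: "(\<And>T. T \<subseteq> N \<Longrightarrow> 0 \<le> f T) \<Longrightarrow> 0 \<le> avg N f"
  by (auto simp: avg_def intro!: sum_nonneg divide_nonneg_nonneg)

lemma avg_Holder:
  assumes "finite N" and "0 < \<theta>" and "\<theta> < 1"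
    and "\<And>T. T \<subseteq> N \<Longrightarrow> 0 \<le> u T" and "\<And>T. T \<subseteq> N \<Longrightarrow> 0 \<le> v T"
  shows "avg N (\<lambda>T. u T powr \<theta> * v T powr (1 - \<theta>)) \<le> avg N u powr \<theta> * avg N v powr (1 - \<theta>)"
proof -
  define D :: real where "D = 2 ^ card N"
  have D: "D > 0" by (simp add: D_def)
  have "D powr \<theta> * D powr (1 - \<theta>) = D"
    using D by (simp flip: powr_add)
  then have "avg N u powr \<theta> * avg N v powr (1 - \<theta>) = sum u (Pow N) powr \<theta> * sum v (Pow N) powr (1 - \<theta>) / D"
    unfolding avg_def D_def[symmetric] using assms D
    by (subst (1 2) powr_divide) (auto intro!: sum_nonneg)
  moreover have "(\<Sum>T\<in>Pow N. u T powr \<theta> * v T powr (1 - \<theta>)) \<le> sum u (Pow N) powr \<theta> * sum v (Pow N) powr (1 - \<theta>)"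
    by (rule Holder_sum_powr) (use assms in auto)
  ultimately show ?thesis
    unfolding avg_def D_def[symmetric] using D by (simp add: divide_right_mono)
qed

lemma chi_empty [simp]: "chi {} T = 1" "chi S {} = 1"
  by (simp_all add: chi_def)

lemma chi_sq [simp]: "chi S T * chi S T = 1"
  by (simp add: chi_def flip: power_mult_distrib)

lemma chi_insert:
  assumes "finite N" and "a \<notin> N" and "S \<subseteq> N" and "T \<subseteq> N"
  shows "chi (insert a S) T = chi S T" and "chi S (insert a T) = chi S T"
    and "chi (insert a S) (insert a T) = - chi S T"
proof -
  have "a \<notin> S" "a \<notin> T" "finite (S \<inter> T)"
    using assms by (auto intro: rev_finite_subset[of N])
  then show "chi (insert a S) T = chi S T" "chi S (insert a T) = chi S T"
    "chi (insert a S) (insert a T) = - chi S T"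
    by (simp_all add: chi_def)
qed

lemma chi_Un:
  assumes "finite I" and "finite K" and "I \<inter> K = {}" and "R \<subseteq> I" and "S \<subseteq> K" and "T1 \<subseteq> I" and "T2 \<subseteq> K"
  shows "chi (R \<union> S) (T1 \<union> T2) = chi R T1 * chi S T2"
proof -
  have "(R \<union> S) \<inter> (T1 \<union> T2) = (R \<inter> T1) \<union> (S \<inter> T2)" using assms by auto
  moreover have "card ((R \<inter> T1) \<union> (S \<inter> T2)) = card (R \<inter> T1) + card (S \<inter> T2)"
    using assms finite_subset by (intro card_Un_disjoint) blast+
  ultimately show ?thesis by (simp add: chi_def power_add)
qed

text \<open>Splitting on coordinate \<open>a\<close>, the character of \<open>insert a S\<close>
  changes sign on the half containing \<open>a\<close>. The resulting half-sum and half-difference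
  drive the induction in \<open>Parseval\<close>.\<close>

lemma coef_insert:
  assumes "finite N" and "a \<notin> N" and "S \<subseteq> N"
  shows "coef (insert a N) f S = (coef N f S + coef N (\<lambda>T. f (insert a T)) S) / 2"
    and "coef (insert a N) f (insert a S) = (coef N f S - coef N (\<lambda>T. f (insert a T)) S) / 2"
proof -
  have e: "avg N (\<lambda>T. f T * chi (insert a S) T) = avg N (\<lambda>T. f T * chi S T)"
    "avg N (\<lambda>T. f (insert a T) * chi S (insert a T)) = avg N (\<lambda>T. f (insert a T) * chi S T)"
    "avg N (\<lambda>T. f (insert a T) * chi (insert a S) (insert a T)) = - avg N (\<lambda>T. f (insert a T) * chi S T)"
    using assms by (auto intro!: avg_cong simp: chi_insert simp flip: avg_minus)
  show "coef (insert a N) f S = (coef N f S + coef N (\<lambda>T. f (insert a T)) S) / 2"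
    "coef (insert a N) f (insert a S) = (coef N f S - coef N (\<lambda>T. f (insert a T)) S) / 2"
    unfolding coef_def using assms by (simp_all add: avg_insert e)
qed

lemma Parseval:
  assumes "finite N"
  shows "(\<Sum>S\<in>Pow N. (coef N f S)\<^sup>2) = avg N (\<lambda>T. (f T)\<^sup>2)"
  using assms
proof (induction N arbitrary: f rule: finite_induct)
  case empty
  show ?case by (simp add: coef_def)
next
  case (insert a N)
  have "(\<Sum>S\<in>Pow (insert a N). (coef (insert a N) f S)\<^sup>2)
      = (\<Sum>S\<in>Pow N. ((coef N f S)\<^sup>2 + (coef N (\<lambda>T. f (insert a T)) S)\<^sup>2) / 2)"
    using insert.hyps
    by (simp add: sum_Pow_insert coef_insert flip: sum.distrib)
       (intro sum.cong refl, simp add: power2_eq_square field_simps)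
  also have "\<dots> = (avg N (\<lambda>T. (f T)\<^sup>2) + avg N (\<lambda>T. (f (insert a T))\<^sup>2)) / 2"
    by (simp add: insert.IH add_divide_distrib sum.distrib flip: sum_divide_distrib)
  finally show ?case using insert.hyps by (simp add: avg_insert)
qed

lemma coef_Un:
  assumes "finite I" and "finite K" and "I \<inter> K = {}" and "R \<subseteq> I" and "S \<subseteq> K"
  shows "coef K (\<lambda>T2. coef I (\<lambda>T1. f (T1 \<union> T2)) R) S = coef (I \<union> K) f (R \<union> S)"
  unfolding coef_def avg_Un[OF assms(1-3)] avg_mult_right[symmetric]
  by (intro avg_cong) (simp add: chi_Un[OF assms] mult_ac)

text \<open>With \<open>T2\<close> frozen on \<open>K\<close>, the coefficient at \<open>R\<close>
  is a function of \<open>T2\<close> whose own Fourier coefficients are those of \<open>f\<close> at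
  the sets \<open>R \<union> S\<close>; Parseval on \<open>K\<close> applies.\<close>

lemma avg_coef_restrict_sq:
  assumes "finite I" and "finite K" and "I \<inter> K = {}" and "R \<subseteq> I"
  shows "avg K (\<lambda>T2. (coef I (\<lambda>T1. f (T1 \<union> T2)) R)\<^sup>2) = (\<Sum>S\<in>Pow K. (coef (I \<union> K) f (R \<union> S))\<^sup>2)"
  using Parseval[OF assms(2), of "\<lambda>T2. coef I (\<lambda>T1. f (T1 \<union> T2)) R"] assms
  by (simp add: coef_Un)

lemma avg_flip:
  assumes "finite N" and "i \<in> N"
  shows "avg N (\<lambda>T. f (sym_diff T {i})) = avg N f"
  unfolding avg_def
  by (rule arg_cong[where f = "\<lambda>x. x / _"],
      rule sum.reindex_bij_witness[of _ "\<lambda>T. sym_diff T {i}" "\<lambda>T. sym_diff T {i}"])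
     (use assms in auto)

lemma chi_flip:
  assumes "finite N" and "i \<in> S" and "S \<subseteq> N" and "T \<subseteq> N"
  shows "chi S (sym_diff T {i}) = - chi S T"
proof -
  define M where "M = N - {i}"
  have M: "finite M" "i \<notin> M" "S - {i} \<subseteq> M" "T - {i} \<subseteq> M" using assms by (auto simp: M_def)
  have S: "S = insert i (S - {i})" using assms by auto
  show ?thesis
  proof (cases "i \<in> T")
    case True
    then have T: "T = insert i (T - {i})" "sym_diff T {i} = T - {i}" by auto
    have "chi S T = - chi (S - {i}) (T - {i})"
      using chi_insert(3)[OF M] S T(1) by simp
    moreover have "chi S (T - {i}) = chi (S - {i}) (T - {i})"
      using chi_insert(1)[OF M] S by simp
    ultimately show ?thesis using T(2) by simp
  next
    case False
    then have T: "T - {i} = T" "sym_diff T {i} = insert i T" by auto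
    show ?thesis using chi_insert(1,3)[OF M] S T by (simp add: insert_absorb assms(2))
  qed
qed

text \<open>For sign-valued \<open>f\<close> the values lie in {-1, 0, 1}, and the average of the
  absolute value is the influence of \<open>i\<close>.\<close>

definition deriv_coord :: "('a set \<Rightarrow> real) \<Rightarrow> 'a \<Rightarrow> 'a set \<Rightarrow> real" where
  "deriv_coord f i T = (f T - f (sym_diff T {i})) / 2"

text \<open>The character of \<open>S\<close> is odd under flipping \<open>i\<close>, while averages
  are invariant, so both halves of the difference contribute equally.\<close>

lemma coef_deriv_coord:
  assumes "finite N" and "i \<in> S" and "S \<subseteq> N"
  shows "coef N (deriv_coord f i) S = coef N f S"
proof -
  have "avg N (\<lambda>T. f (sym_diff T {i}) * chi S T) = - avg N (\<lambda>T. f (sym_diff T {i}) * chi S (sym_diff T {i}))"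
    using assms by (subst avg_minus[symmetric], intro avg_cong) (simp add: chi_flip)
  also have "avg N (\<lambda>T. f (sym_diff T {i}) * chi S (sym_diff T {i})) = coef N f S"
    unfolding coef_def using avg_flip[of N i "\<lambda>T. f T * chi S T"] assms by auto
  finally show ?thesis
    unfolding coef_def deriv_coord_def
    by (simp add: left_diff_distrib avg_divide avg_diff diff_divide_distrib coef_def)
qed

section \<open>Hypercontractivity\<close>

text \<open>Bridges natural and real exponents for Holder's inequality. Positivity of
  \<open>m\<close> matters at \<open>u = 0\<close>, where \<open>0 ^ 0 = 1\<close> but
  \<open>0 powr 0 = 0\<close>.\<close>

lemma pow_powr_ratio:
  fixes u :: real
  assumes "0 \<le> u" and "0 < m" and "0 < k"
  shows "(u ^ k) powr (real m / real k) = u ^ m"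
proof (cases "u = 0")
  case False
  then have "u > 0" using assms by simp
  then have "(u ^ k) powr (real m / real k) = (u powr real k) powr (real m / real k)"
    by (simp add: powr_realpow)
  also have "\<dots> = u ^ m"
    using \<open>u > 0\<close> assms(3) by (simp add: powr_powr powr_realpow[symmetric])
  finally show ?thesis .
qed (use assms in \<open>simp add: zero_power\<close>)

text \<open>Holder with weights \<open>(k - j) / k\<close> and \<open>j / k\<close>. At
  \<open>j = 0\<close> and \<open>j = k\<close>, where a weight degenerates, the claim is one of the
  moment hypotheses.\<close>

lemma avg_mixed_moment:
  assumes "finite N" and "0 < k" and "j \<le> k"
    and u: "\<And>T. T \<subseteq> N \<Longrightarrow> 0 \<le> u T" and v: "\<And>T. T \<subseteq> N \<Longrightarrow> 0 \<le> v T"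
    and "0 \<le> \<alpha>" and "0 \<le> \<beta>"
    and mu: "avg N (\<lambda>T. u T ^ k) \<le> \<alpha> ^ k" and mv: "avg N (\<lambda>T. v T ^ k) \<le> \<beta> ^ k"
  shows "avg N (\<lambda>T. u T ^ (k - j) * v T ^ j) \<le> \<alpha> ^ (k - j) * \<beta> ^ j"
proof -
  consider "j = 0" | "j = k" | "0 < j" "j < k" using assms(3) by linarith
  then show ?thesis
  proof cases
    case 3
    define \<theta> where "\<theta> = real (k - j) / real k"
    have \<theta>: "0 < \<theta>" "\<theta> < 1" and \<theta>': "1 - \<theta> = real j / real k"
      using 3 by (auto simp: \<theta>_def of_nat_diff field_simps)
    have "avg N (\<lambda>T. u T ^ (k - j) * v T ^ j) = avg N (\<lambda>T. (u T ^ k) powr \<theta> * (v T ^ k) powr (1 - \<theta>))"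
      unfolding \<theta>' unfolding \<theta>_def using 3 u v by (intro avg_cong) (simp add: pow_powr_ratio del: of_nat_diff)
    also have "\<dots> \<le> avg N (\<lambda>T. u T ^ k) powr \<theta> * avg N (\<lambda>T. v T ^ k) powr (1 - \<theta>)"
      by (rule avg_Holder) (use assms \<theta> in auto)
    also have "\<dots> \<le> (\<alpha> ^ k) powr \<theta> * (\<beta> ^ k) powr (1 - \<theta>)"
      using \<theta> mu mv u v by (intro mult_mono powr_mono2 avg_nonneg) auto
    also have "\<dots> = \<alpha> ^ (k - j) * \<beta> ^ j"
      unfolding \<theta>' unfolding \<theta>_def using 3 assms by (simp add: pow_powr_ratio del: of_nat_diff)
    finally show ?thesis .
  qed (use assms in auto)
qed

lemma even_binomial_expansion:
  fixes x y :: real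
  shows "((x + y) ^ (2 * k) + (x - y) ^ (2 * k)) / 2
    = (\<Sum>j\<le>k. real ((2 * k) choose (2 * j)) * ((x\<^sup>2) ^ (k - j) * (y\<^sup>2) ^ j))"
proof -
  \<comment> \<open>The summands are swapped so that the index in \<open>binomial_ring\<close> is
    the exponent of \<open>y\<close>; odd exponents then cancel.\<close>
  have "((x + y) ^ (2 * k) + (x - y) ^ (2 * k)) / 2 = ((y + x) ^ (2 * k) + (- y + x) ^ (2 * k)) / 2"
    by (simp add: algebra_simps)
  also have "\<dots> = (\<Sum>i\<le>2 * k. if even i then real ((2 * k) choose i) * (x ^ (2 * k - i) * y ^ i) else 0)"
    unfolding binomial_ring sum.distrib[symmetric] sum_divide_distrib
    by (intro sum.cong) (auto simp: algebra_simps)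
  \<comment> \<open>The added odd index \<open>2 * k + 1\<close> contributes 0 and makes the range
    split evenly into even and odd indices.\<close>
  also have "\<dots> = (\<Sum>i<2 * Suc k. if even i then real ((2 * k) choose i) * (x ^ (2 * k - i) * y ^ i) else 0)"
    by (rule sum.mono_neutral_left) auto
  also have "\<dots> = (\<Sum>j<Suc k. real ((2 * k) choose (2 * j)) * (x ^ (2 * k - 2 * j) * y ^ (2 * j)))"
    unfolding sum_split_even_odd by simp
  also have "\<dots> = (\<Sum>j\<le>k. real ((2 * k) choose (2 * j)) * ((x\<^sup>2) ^ (k - j) * (y\<^sup>2) ^ j))"
    by (simp only: lessThan_Suc_atMost diff_mult_distrib2[symmetric] power_mult)
  finally show ?thesis .
qed

text \<open>The base is \<open>(2 * k)^2\<close>. The factor \<open>k choose j\<close>, at least 1,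
  is inserted so that the sum in \<open>Bonami\<close> folds back into a binomial power.\<close>

lemma choose_double_le:
  assumes "j \<le> k"
  shows "real ((2 * k) choose (2 * j)) \<le> real (k choose j) * (4 * (real k)\<^sup>2) ^ j"
proof -
  have "(2 * k) choose (2 * j) \<le> (2 * k) ^ (2 * j)"
    using assms by (intro binomial_le_pow) auto
  then have "real ((2 * k) choose (2 * j)) \<le> real ((2 * k) ^ (2 * j))"
    by (rule of_nat_mono)
  also have "\<dots> = 1 * (4 * (real k)\<^sup>2) ^ j"
    by (simp add: power_mult power_mult_distrib)
  also have "\<dots> \<le> real (k choose j) * (4 * (real k)\<^sup>2) ^ j"
    using assms by (intro mult_right_mono) (auto simp: Suc_le_eq)
  finally show ?thesis .
qed

text \<open>Hypercontractivity from the 2-norm to the \<open>2 * k\<close>-norm, by induction on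
  coordinates. The polynomial is \<open>p + q\<close> or \<open>p - q\<close> according to
  membership of \<open>a\<close>; odd powers of \<open>q\<close> cancel, and Holder with the
  induction hypotheses for \<open>p\<close> and \<open>q\<close> bounds the mixed moments.\<close>

theorem Bonami:
  fixes c :: "'a set \<Rightarrow> real"
  assumes "finite N" and k: "0 < k"
  shows "avg N (\<lambda>T. (\<Sum>S\<in>Pow N. c S * chi S T) ^ (2 * k))
    \<le> (\<Sum>S\<in>Pow N. (4 * (real k)\<^sup>2) ^ card S * (c S)\<^sup>2) ^ k"
  using assms(1)
proof (induction N arbitrary: c rule: finite_induct)
  case empty
  show ?case by (simp add: power_mult)
next
  case (insert a N)
  define C where "C = 4 * (real k)\<^sup>2"
  define p where "p T = (\<Sum>S\<in>Pow N. c S * chi S T)" for T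
  define q where "q T = (\<Sum>S\<in>Pow N. c (insert a S) * chi S T)" for T
  define \<alpha> where "\<alpha> = (\<Sum>S\<in>Pow N. C ^ card S * (c S)\<^sup>2)"
  define \<beta> where "\<beta> = (\<Sum>S\<in>Pow N. C ^ card S * (c (insert a S))\<^sup>2)"
  have nonneg: "0 \<le> C" "0 \<le> \<alpha>" "0 \<le> \<beta>"
    by (auto simp: C_def \<alpha>_def \<beta>_def intro!: sum_nonneg)
  have pm: "(\<Sum>S\<in>Pow (insert a N). c S * chi S T) = p T + q T"
    "(\<Sum>S\<in>Pow (insert a N). c S * chi S (insert a T)) = p T - q T" if "T \<subseteq> N" for T
    using insert.hyps that unfolding p_def q_def
    by (simp_all add: sum_Pow_insert chi_insert sum_negf)
  have "avg (insert a N) (\<lambda>T. (\<Sum>S\<in>Pow (insert a N). c S * chi S T) ^ (2 * k))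
      = avg N (\<lambda>T. ((p T + q T) ^ (2 * k) + (p T - q T) ^ (2 * k)) / 2)"
    unfolding avg_insert[OF insert.hyps] avg_add[symmetric] avg_divide[symmetric]
    by (intro avg_cong) (simp add: pm)
  also have "\<dots> = (\<Sum>j\<le>k. real ((2 * k) choose (2 * j)) * avg N (\<lambda>T. ((p T)\<^sup>2) ^ (k - j) * ((q T)\<^sup>2) ^ j))"
    by (simp only: even_binomial_expansion avg_sum avg_mult_left)
  also have "\<dots> \<le> (\<Sum>j\<le>k. (real (k choose j) * C ^ j) * (\<alpha> ^ (k - j) * \<beta> ^ j))"
  proof (intro sum_mono mult_mono)
    fix j assume j: "j \<in> {..k}"
    show "real (2 * k choose (2 * j)) \<le> real (k choose j) * C ^ j"
      unfolding C_def using choose_double_le j by simp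
    show "avg N (\<lambda>T. ((p T)\<^sup>2) ^ (k - j) * ((q T)\<^sup>2) ^ j) \<le> \<alpha> ^ (k - j) * \<beta> ^ j"
      by (rule avg_mixed_moment)
        (use insert.hyps insert.IH[of c] insert.IH[of "\<lambda>S. c (insert a S)"] nonneg k j
          in \<open>auto simp: p_def q_def \<alpha>_def \<beta>_def C_def simp flip: power_mult\<close>)
    show "0 \<le> avg N (\<lambda>T. ((p T)\<^sup>2) ^ (k - j) * ((q T)\<^sup>2) ^ j)"
      by (rule avg_nonneg) simp
  qed (use nonneg in auto)
  also have "\<dots> = (C * \<beta> + \<alpha>) ^ k"
    unfolding binomial_ring by (intro sum.cong) (auto simp: power_mult_distrib)
  \<comment> \<open>The extra factor \<open>C\<close> on \<open>\<beta>\<close> accounts for the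
    point \<open>a\<close> added to each of those sets.\<close>
  also have "C * \<beta> + \<alpha> = (\<Sum>S\<in>Pow (insert a N). C ^ card S * (c S)\<^sup>2)"
  proof -
    have "card (insert a S) = Suc (card S)" if "S \<subseteq> N" for S
      using that insert.hyps by (auto simp: finite_subset card_insert_if)
    then show ?thesis
      using insert.hyps unfolding \<alpha>_def \<beta>_def
      by (simp add: sum_Pow_insert sum_distrib_left mult.assoc)
  qed
  finally show ?case unfolding C_def .
qed

text \<open>Hypercontractive duality: test \<open>h\<close> against its own low-degree part.\<close>

lemma low_degree_weight_le:
  assumes "finite N" and k: "0 < k" and F: "F \<subseteq> Pow N" and d: "\<And>S. S \<in> F \<Longrightarrow> card S \<le> d"
    and h: "\<And>T. T \<subseteq> N \<Longrightarrow> h T \<in> {-1, 0, 1}"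
  shows "(\<Sum>S\<in>F. (coef N h S)\<^sup>2) \<le> (4 * (real k)\<^sup>2) ^ d * avg N (\<lambda>T. \<bar>h T\<bar>) powr (2 - 1 / real k)"
proof -
  define C where "C = 4 * (real k)\<^sup>2"
  define c where "c S = (if S \<in> F then coef N h S else 0)" for S
  define g where "g T = (\<Sum>S\<in>Pow N. c S * chi S T)" for T
  define V where "V = (\<Sum>S\<in>F. (coef N h S)\<^sup>2)"
  define P where "P = avg N (\<lambda>T. \<bar>h T\<bar>)"
  \<comment> \<open>This is the Holder weight that turns the \<open>2 * k\<close>-th moment of
    \<open>g\<close> into its norm.\<close>
  define \<theta> where "\<theta> = 1 / (2 * real k)"
  have \<theta>: "0 < \<theta>" "\<theta> < 1" using k by (auto simp: \<theta>_def field_simps)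
  have P: "0 \<le> P" unfolding P_def by (rule avg_nonneg) simp
  have V: "0 \<le> V" unfolding V_def by (rule sum_nonneg) simp
  have k1: "real k \<ge> 1" using k by simp
  then have "(real k)\<^sup>2 \<ge> 1" by simp
  then have C: "C \<ge> 1" unfolding C_def by linarith
  have VF: "V = (\<Sum>S\<in>Pow N. (c S)\<^sup>2)"
    unfolding V_def by (rule sum.mono_neutral_cong_left) (use assms in \<open>auto simp: c_def\<close>)
  have "avg N (\<lambda>T. h T * g T) = (\<Sum>S\<in>Pow N. c S * coef N h S)"
    unfolding g_def coef_def sum_distrib_left avg_sum avg_mult_left[symmetric]
    by (simp add: mult_ac)
  also have "\<dots> = V"
    unfolding VF by (intro sum.cong) (auto simp: c_def power2_eq_square)
  finally have "V = avg N (\<lambda>T. h T * g T)" by simp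
  \<comment> \<open>Since \<open>h\<close> takes values in {-1, 0, 1}, raising its absolute value to
    the power \<open>1 - \<theta>\<close> changes nothing.\<close>
  also have "\<dots> \<le> avg N (\<lambda>T. (g T ^ (2 * k)) powr \<theta> * \<bar>h T\<bar> powr (1 - \<theta>))"
  proof (rule avg_mono)
    fix T assume T: "T \<subseteq> N"
    have "(\<bar>g T\<bar> ^ (2 * k)) powr (real 1 / real (2 * k)) = \<bar>g T\<bar> ^ 1"
      using k by (intro pow_powr_ratio) auto
    then have "(g T ^ (2 * k)) powr \<theta> = \<bar>g T\<bar>" by (simp add: \<theta>_def power_even_abs)
    then show "h T * g T \<le> (g T ^ (2 * k)) powr \<theta> * \<bar>h T\<bar> powr (1 - \<theta>)"
      using h[OF T] by auto
  qed
  also have "\<dots> \<le> avg N (\<lambda>T. g T ^ (2 * k)) powr \<theta> * P powr (1 - \<theta>)"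
    unfolding P_def by (rule avg_Holder) (use assms \<theta> in auto)
  also have "\<dots> \<le> ((C ^ d * V) ^ k) powr \<theta> * P powr (1 - \<theta>)"
  proof (intro mult_right_mono powr_mono2)
    have "avg N (\<lambda>T. g T ^ (2 * k)) \<le> (\<Sum>S\<in>Pow N. C ^ card S * (c S)\<^sup>2) ^ k"
      unfolding g_def C_def by (rule Bonami[OF assms(1) k])
    also have "\<dots> \<le> (C ^ d * V) ^ k"
      unfolding VF sum_distrib_left
      by (intro power_mono sum_mono sum_nonneg)
        (use C d in \<open>auto simp: c_def intro!: mult_right_mono power_increasing\<close>)
    finally show "avg N (\<lambda>T. g T ^ (2 * k)) \<le> (C ^ d * V) ^ k" .
  qed (use \<theta> in \<open>auto intro!: avg_nonneg\<close>)
  also have "((C ^ d * V) ^ k) powr \<theta> = sqrt (C ^ d * V)"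
  proof -
    have "((sqrt (C ^ d * V)) ^ (2 * k)) powr (real 1 / real (2 * k)) = (sqrt (C ^ d * V)) ^ 1"
      using k C V by (intro pow_powr_ratio) auto
    moreover have "(sqrt (C ^ d * V)) ^ (2 * k) = (C ^ d * V) ^ k"
      using C V by (simp add: power_mult)
    ultimately show ?thesis by (simp add: \<theta>_def)
  qed
  finally have "V \<le> sqrt (C ^ d * V) * P powr (1 - \<theta>)" .
  then have "V\<^sup>2 \<le> (sqrt (C ^ d * V) * P powr (1 - \<theta>))\<^sup>2"
    using V by (intro power_mono)
  also have "\<dots> = C ^ d * V * P powr (2 - 1 / real k)"
  proof -
    have "(P powr (1 - \<theta>))\<^sup>2 = P powr ((1 - \<theta>) + (1 - \<theta>))"
      by (simp only: power2_eq_square powr_add)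
    also have "(1 - \<theta>) + (1 - \<theta>) = 2 - 1 / real k" by (simp add: \<theta>_def)
    finally show ?thesis using C V by (simp add: power_mult_distrib)
  qed
  \<comment> \<open>After squaring, the right-hand side is linear in \<open>V\<close>, so one factor
    \<open>V\<close> cancels.\<close>
  finally have "V * V \<le> V * (C ^ d * P powr (2 - 1 / real k))"
    by (simp add: power2_eq_square mult_ac)
  then have "V \<le> C ^ d * P powr (2 - 1 / real k)"
    using V C by (cases "V = 0") auto
  then show ?thesis unfolding V_def C_def P_def .
qed

section \<open>Noise sensitivity\<close>

text \<open>The set of counted directions need not be the whole domain: \<open>sens I f\<close> with
  \<open>I \<subseteq> N\<close> counts only flips of live coordinates.\<close>

definition sens :: "'a set \<Rightarrow> ('a set \<Rightarrow> real) \<Rightarrow> 'a set \<Rightarrow> nat" where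
  "sens N f T = card {i \<in> N. f (sym_diff T {i}) \<noteq> f T}"

lemma deriv_coord_sign:
  assumes "f T \<in> {-1, 1}" and "f (sym_diff T {i}) \<in> {-1, 1}"
  shows "deriv_coord f i T \<in> {-1, 0, 1}"
    and "\<bar>deriv_coord f i T\<bar> = of_bool (f (sym_diff T {i}) \<noteq> f T)"
    and "(deriv_coord f i T)\<^sup>2 = of_bool (f (sym_diff T {i}) \<noteq> f T)"
  using assms by (auto simp: deriv_coord_def)

lemma sens_eq_sum:
  assumes "finite N"
  shows "real (sens N f T) = (\<Sum>i\<in>N. of_bool (f (sym_diff T {i}) \<noteq> f T))"
  using assms by (simp add: sens_def of_bool_def sum.If_cases Int_def)

lemma sum_coef_sq_sign:
  assumes N: "finite N" and f: "\<And>T. T \<subseteq> N \<Longrightarrow> f T \<in> {-1, 1}"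
  shows "(\<Sum>S\<in>Pow N. (coef N f S)\<^sup>2) = 1"
proof -
  have "(f T)\<^sup>2 = 1" if "T \<subseteq> N" for T using f[OF that] by auto
  then have "(\<Sum>S\<in>Pow N. (coef N f S)\<^sup>2) = avg N (\<lambda>T. 1)"
    unfolding Parseval[OF N] by (intro avg_cong) auto
  then show ?thesis using N by (simp add: avg_const)
qed

text \<open>The level-1 coefficients form a vector of norm at most 1, so pairing it with the gradient of
  \<open>f\<close> and applying Cauchy--Schwarz pointwise gives the bound.\<close>

lemma level1_le_avg_sqrt_sens:
  assumes N: "finite N" and f: "\<And>T. T \<subseteq> N \<Longrightarrow> f T \<in> {-1, 1}"
  shows "(\<Sum>i\<in>N. (coef N f {i})\<^sup>2) \<le> avg N (\<lambda>T. sqrt (sens N f T))"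
proof -
  define W where "W = (\<Sum>i\<in>N. (coef N f {i})\<^sup>2)"
  have "W = (\<Sum>S\<in>(\<lambda>i. {i}) ` N. (coef N f S)\<^sup>2)"
    unfolding W_def by (simp add: sum.reindex)
  also have "\<dots> \<le> (\<Sum>S\<in>Pow N. (coef N f S)\<^sup>2)"
    using N by (intro sum_mono2) auto
  also have "\<dots> = 1" by (rule sum_coef_sq_sign[OF N f])
  finally have W1: "W \<le> 1" .
  have W0: "0 \<le> W" unfolding W_def by (rule sum_nonneg) simp
  have "W = (\<Sum>i\<in>N. coef N f {i} * coef N (deriv_coord f i) {i})"
    unfolding W_def using N by (intro sum.cong) (auto simp: coef_deriv_coord power2_eq_square)
  also have "\<dots> = avg N (\<lambda>T. \<Sum>i\<in>N. (coef N f {i} * chi {i} T) * deriv_coord f i T)"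
    unfolding coef_def[of N "deriv_coord f _"] avg_sum avg_mult_left[symmetric]
    by (simp add: mult_ac)
  also have "\<dots> \<le> avg N (\<lambda>T. sqrt (sens N f T))"
  proof (rule avg_mono)
    fix T assume T: "T \<subseteq> N"
    have fl: "sym_diff T {i} \<subseteq> N" if "i \<in> N" for i using that T by auto
    have "(\<Sum>i\<in>N. (coef N f {i} * chi {i} T) * deriv_coord f i T)\<^sup>2
        \<le> (\<Sum>i\<in>N. (coef N f {i} * chi {i} T)\<^sup>2) * (\<Sum>i\<in>N. (deriv_coord f i T)\<^sup>2)"
      by (rule Cauchy_Schwarz_ineq_sum)
    also have "(\<Sum>i\<in>N. (coef N f {i} * chi {i} T)\<^sup>2) = W"
      unfolding W_def by (simp add: power_mult_distrib power2_eq_square[of "chi _ _"])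
    also have "(\<Sum>i\<in>N. (deriv_coord f i T)\<^sup>2) = sens N f T"
      unfolding sens_eq_sum[OF N]
      by (intro sum.cong refl deriv_coord_sign(3) f T fl)
    also have "W * real (sens N f T) \<le> 1 * real (sens N f T)"
      using W1 by (intro mult_right_mono) auto
    finally show "(\<Sum>i\<in>N. (coef N f {i} * chi {i} T) * deriv_coord f i T) \<le> sqrt (sens N f T)"
      by (simp add: real_le_rsqrt)
  qed
  finally show ?thesis unfolding W_def .
qed

text \<open>The left-hand side is the weight of the sets meeting \<open>I\<close> in one point, i.e. the mean level-1
  weight of the restrictions of \<open>f\<close> to \<open>I\<close>.\<close>

lemma avg_sens_powr_ge:
  assumes N: "finite N" and I: "I \<subseteq> N" and f: "\<And>T. T \<subseteq> N \<Longrightarrow> f T \<in> {-1, 1}" and p: "1 / 2 \<le> p"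
  shows "(\<Sum>S\<in>Pow N. (coef N f S)\<^sup>2 * (\<Sum>i\<in>S. of_bool (I \<inter> S = {i})))
    \<le> avg N (\<lambda>T. real (sens I f T) powr p)"
proof -
  define K where "K = N - I"
  have fin: "finite I" "finite K" and IK: "I \<inter> K = {}" "I \<union> K = N"
    using N I finite_subset by (auto simp: K_def)
  have "(\<Sum>S\<in>Pow N. (coef N f S)\<^sup>2 * (\<Sum>i\<in>S. of_bool (I \<inter> S = {i})))
      = (\<Sum>S\<in>Pow N. \<Sum>i\<in>I. (coef N f S)\<^sup>2 * of_bool (I \<inter> S = {i}))"
  proof (rule sum.cong[OF refl])
    fix S assume "S \<in> Pow N"
    then have "finite S" using N finite_subset by auto
    then have "(\<Sum>i\<in>S. of_bool (I \<inter> S = {i})) = (\<Sum>i\<in>I. of_bool (I \<inter> S = {i}) :: real)"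
      using fin by (intro sum.mono_neutral_cong) auto
    then show "(coef N f S)\<^sup>2 * (\<Sum>i\<in>S. of_bool (I \<inter> S = {i})) = (\<Sum>i\<in>I. (coef N f S)\<^sup>2 * of_bool (I \<inter> S = {i}))"
      by (simp add: sum_distrib_left)
  qed
  also have "\<dots> = (\<Sum>i\<in>I. \<Sum>S\<in>Pow N. (coef N f S)\<^sup>2 * of_bool (I \<inter> S = {i}))"
    by (rule sum.swap)
  also have "\<dots> = (\<Sum>i\<in>I. \<Sum>S\<in>Pow K. (coef N f ({i} \<union> S))\<^sup>2)"
  proof (rule sum.cong[OF refl])
    fix i assume i: "i \<in> I"
    have "(\<Sum>S\<in>Pow N. (coef N f S)\<^sup>2 * of_bool (I \<inter> S = {i})) = (\<Sum>S\<in>{S \<in> Pow N. I \<inter> S = {i}}. (coef N f S)\<^sup>2)"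
      using N by (intro sum.mono_neutral_cong_right) auto
    also have "\<dots> = (\<Sum>S\<in>Pow K. (coef N f ({i} \<union> S))\<^sup>2)"
      by (rule sum.reindex_bij_witness[of _ "\<lambda>S. {i} \<union> S" "\<lambda>S. S - {i}"])
        (use i IK I in \<open>auto simp: insert_absorb K_def intro!: arg_cong[where f = "\<lambda>S. (coef N f S)\<^sup>2"]\<close>)
    finally show "(\<Sum>S\<in>Pow N. (coef N f S)\<^sup>2 * of_bool (I \<inter> S = {i})) = (\<Sum>S\<in>Pow K. (coef N f ({i} \<union> S))\<^sup>2)" .
  qed
  also have "\<dots> = avg K (\<lambda>T2. \<Sum>i\<in>I. (coef I (\<lambda>T1. f (T1 \<union> T2)) {i})\<^sup>2)"
    unfolding avg_sum using fin IK by (intro sum.cong refl) (simp add: avg_coef_restrict_sq)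
  \<comment> \<open>The level-1 bound is applied to each restriction obtained by freezing the
    coordinates in \<open>K\<close>.\<close>
  also have "\<dots> \<le> avg K (\<lambda>T2. avg I (\<lambda>T1. sqrt (sens I (\<lambda>T1. f (T1 \<union> T2)) T1)))"
    by (intro avg_mono level1_le_avg_sqrt_sens fin f) (use IK in blast)
  also have "\<dots> \<le> avg K (\<lambda>T2. avg I (\<lambda>T1. real (sens I f (T1 \<union> T2)) powr p))"
  proof (intro avg_mono)
    fix T2 T1 assume T: "T2 \<subseteq> K" "T1 \<subseteq> I"
    have "sym_diff (T1 \<union> T2) {i} = sym_diff T1 {i} \<union> T2" if "i \<in> I" for i
      using that T IK by auto
    then have "sens I (\<lambda>T1. f (T1 \<union> T2)) T1 = sens I f (T1 \<union> T2)"
      unfolding sens_def by (intro arg_cong[where f = card]) auto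
    \<comment> \<open>A natural number is 0 or at least 1, so raising the exponent from 1/2 to
      \<open>p\<close> cannot decrease the value.\<close>
    moreover have "sqrt (real m) \<le> real m powr p" for m :: nat
      using p by (cases "m = 0") (auto simp flip: powr_half_sqrt intro!: powr_mono)
    ultimately show "sqrt (sens I (\<lambda>T1. f (T1 \<union> T2)) T1) \<le> real (sens I f (T1 \<union> T2)) powr p"
      by simp
  qed
  also have "\<dots> = avg N (\<lambda>T. real (sens I f T) powr p)"
    using avg_Un[OF fin IK(1)] IK(2) by simp
  finally show ?thesis .
qed

section \<open>Random sets of live coordinates\<close>

text \<open>The law of a random subset of \<open>N\<close> containing each point independently with probability \<open>\<delta>\<close>.\<close>

definition subset_weight :: "'a set \<Rightarrow> real \<Rightarrow> 'a set \<Rightarrow> real" where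
  "subset_weight N \<delta> I = \<delta> ^ card I * (1 - \<delta>) ^ card (N - I)"

lemma subset_weight_nonneg: "0 \<le> \<delta> \<Longrightarrow> \<delta> \<le> 1 \<Longrightarrow> 0 \<le> subset_weight N \<delta> I"
  by (simp add: subset_weight_def)

lemma sum_subset_weight:
  assumes "finite N"
  shows "(\<Sum>I\<in>Pow N. subset_weight N \<delta> I) = 1"
  using prod_add[OF assms, of "\<lambda>_. \<delta>" "\<lambda>_. 1 - \<delta>"] by (simp add: subset_weight_def)

lemma sum_subset_weight_inter:
  assumes N: "finite N" and "i \<in> S" and "S \<subseteq> N"
  shows "(\<Sum>I\<in>Pow N. subset_weight N \<delta> I * of_bool (I \<inter> S = {i})) = \<delta> * (1 - \<delta>) ^ (card S - 1)"
proof -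
  \<comment> \<open>\<open>a j\<close> is the factor for \<open>j \<in> I\<close> and
    \<open>b j\<close> the one for \<open>j \<notin> I\<close>, each set to zero where the event
    forbids it. Expanding the product of \<open>a j + b j\<close> over \<open>N\<close> gives the
    sum over all \<open>I\<close>.\<close>
  define a where "a j = \<delta> * of_bool (j \<notin> S \<or> j = i)" for j
  define b where "b j = (1 - \<delta>) * of_bool (j \<noteq> i)" for j
  have "(\<Sum>I\<in>Pow N. subset_weight N \<delta> I * of_bool (I \<inter> S = {i})) = (\<Sum>I\<in>Pow N. prod a I * prod b (N - I))"
  proof (rule sum.cong[OF refl])
    fix I assume "I \<in> Pow N"
    then have fin: "finite I" "finite (N - I)" using N finite_subset by auto
    have eq: "(I \<inter> S = {i}) \<longleftrightarrow> (\<forall>j\<in>I. j \<notin> S \<or> j = i) \<and> (\<forall>j\<in>N - I. j \<noteq> i)"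
      using assms by auto
    have "prod a I = \<delta> ^ card I * of_bool (\<forall>j\<in>I. j \<notin> S \<or> j = i)"
      unfolding a_def prod.distrib using fin by (auto simp: prod_zero_iff)
    moreover have "prod b (N - I) = (1 - \<delta>) ^ card (N - I) * of_bool (\<forall>j\<in>N - I. j \<noteq> i)"
      unfolding b_def prod.distrib using fin by (auto simp: prod_zero_iff)
    ultimately show "subset_weight N \<delta> I * of_bool (I \<inter> S = {i}) = prod a I * prod b (N - I)"
      unfolding eq subset_weight_def by (simp add: mult_ac)
  qed
  also have "\<dots> = (\<Prod>j\<in>N. a j + b j)" using prod_add[OF N, of a b] by simp
  also have "\<dots> = (\<Prod>j\<in>S. a j + b j)"
    by (rule prod.mono_neutral_right) (use assms in \<open>auto simp: a_def b_def\<close>)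
  also have "\<dots> = (a i + b i) * (\<Prod>j\<in>S - {i}. a j + b j)"
    using assms finite_subset by (subst prod.remove[of S i]) auto
  also have "(\<Prod>j\<in>S - {i}. a j + b j) = (\<Prod>j\<in>S - {i}. 1 - \<delta>)"
    by (intro prod.cong) (auto simp: a_def b_def)
  finally show ?thesis using assms by (simp add: a_def b_def)
qed

text \<open>By concavity, the power lies below its tangent at \<open>t = m\<close>.\<close>

lemma powr_tangent_le:
  fixes t m :: real
  assumes "0 < p" and "p \<le> 1" and "0 \<le> t" and "0 < m"
  shows "t powr p \<le> m powr p * (p * (t / m) + (1 - p))"
proof (cases "t = 0")
  case False
  then have "(t / m) powr p * 1 powr (1 - p) \<le> p * (t / m) + (1 - p) * 1"
    using assms by (intro Youngs_inequality_0) auto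
  then have "m powr p * (t powr p / m powr p) \<le> m powr p * (p * (t / m) + (1 - p))"
    using assms False by (intro mult_left_mono) (auto simp: powr_divide)
  then show ?thesis using assms by simp
qed (use assms in auto)

text \<open>Jensen's inequality for the concave power, by averaging its tangent at the mean
  \<open>m = \<delta> * card B\<close>. That mean must be positive, hence the separate case
  \<open>card B = 0\<close>.\<close>

lemma sum_subset_weight_sens_le:
  assumes N: "finite N" and "0 < \<delta>" and "\<delta> \<le> 1" and "0 < p" and "p \<le> 1"
  shows "(\<Sum>I\<in>Pow N. subset_weight N \<delta> I * real (sens I f T) powr p) \<le> \<delta> powr p * real (sens N f T) powr p"
proof -
  let ?w = "subset_weight N \<delta>"
  define B where "B = {i \<in> N. f (sym_diff T {i}) \<noteq> f T}"
  have fB: "finite B" using N by (simp add: B_def)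
  \<comment> \<open>Membership of \<open>i\<close> in \<open>I\<close> is written as an intersection
    to match \<open>sum_subset_weight_inter\<close> with \<open>S = {i}\<close>.\<close>
  have sB: "real (sens I f T) = (\<Sum>i\<in>B. of_bool (I \<inter> {i} = {i}))" if "I \<subseteq> N" for I
  proof -
    have "{i \<in> I. f (sym_diff T {i}) \<noteq> f T} = {i \<in> B. I \<inter> {i} = {i}}"
      using that by (auto simp: B_def)
    then show ?thesis
      unfolding sens_def using fB by (simp add: of_bool_def sum.If_cases Int_def)
  qed
  have sN: "real (sens N f T) = card B" by (simp add: sens_def B_def)
  have mean: "(\<Sum>I\<in>Pow N. ?w I * real (sens I f T)) = \<delta> * card B"
  proof -
    have "(\<Sum>I\<in>Pow N. ?w I * real (sens I f T)) = (\<Sum>I\<in>Pow N. \<Sum>i\<in>B. ?w I * of_bool (I \<inter> {i} = {i}))"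
      by (intro sum.cong refl) (simp add: sB sum_distrib_left)
    also have "\<dots> = (\<Sum>i\<in>B. \<Sum>I\<in>Pow N. ?w I * of_bool (I \<inter> {i} = {i}))"
      by (rule sum.swap)
    also have "\<dots> = (\<Sum>i\<in>B. \<delta>)"
      by (intro sum.cong refl, subst sum_subset_weight_inter) (use N in \<open>auto simp: B_def\<close>)
    finally show ?thesis by simp
  qed
  show ?thesis
  proof (cases "card B = 0")
    case True
    then have "B = {}" using fB by simp
    then have "real (sens I f T) = 0" if "I \<subseteq> N" for I using sB[OF that] by simp
    then have "(\<Sum>I\<in>Pow N. ?w I * real (sens I f T) powr p) = 0"
      by (intro sum.neutral) auto
    then show ?thesis by simp
  next
    case False
    define m where "m = \<delta> * card B"
    have m: "m > 0" using False assms by (simp add: m_def)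
    have "(\<Sum>I\<in>Pow N. ?w I * real (sens I f T) powr p)
        \<le> (\<Sum>I\<in>Pow N. ?w I * (m powr p * (p * (real (sens I f T) / m) + (1 - p))))"
      using assms m by (intro sum_mono mult_left_mono powr_tangent_le subset_weight_nonneg) auto
    also have "\<dots> = m powr p * (p * ((\<Sum>I\<in>Pow N. ?w I * real (sens I f T)) / m) + (1 - p) * (\<Sum>I\<in>Pow N. ?w I))"
      unfolding sum_divide_distrib sum_distrib_left sum.distrib[symmetric]
      by (intro sum.cong refl) (simp add: algebra_simps)
    also have "\<dots> = m powr p"
      using m N by (simp add: mean sum_subset_weight flip: m_def)
    also have "\<dots> = \<delta> powr p * real (card B) powr p"
      using assms by (simp add: m_def powr_mult)
    finally show ?thesis unfolding sN .
  qed
qed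

lemma sum_mult_sum_swap:
  fixes a :: "'a \<Rightarrow> real" and b :: "'b \<Rightarrow> real"
  shows "(\<Sum>x\<in>X. a x * (\<Sum>y\<in>Y. b y * g y x)) = (\<Sum>y\<in>Y. b y * (\<Sum>x\<in>X. a x * g y x))"
  unfolding sum_distrib_left by (subst sum.swap) (intro sum.cong refl mult.left_commute)

text \<open>The left-hand side is \<open>\<delta>\<close> times the derivative in \<open>\<delta>\<close> of the noise sensitivity below; it arises by
  averaging the bound for fixed \<open>I\<close> over a \<open>\<delta>\<close>-random set \<open>I\<close>.\<close>

lemma noise_derivative_le:
  assumes N: "finite N" and f: "\<And>T. T \<subseteq> N \<Longrightarrow> f T \<in> {-1, 1}" and p: "1 / 2 \<le> p" "p \<le> 1"
    and \<delta>: "0 < \<delta>" "\<delta> \<le> 1"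
  shows "(\<Sum>S\<in>Pow N. (coef N f S)\<^sup>2 * (real (card S) * (\<delta> * (1 - \<delta>) ^ (card S - 1))))
    \<le> \<delta> powr p * avg N (\<lambda>T. real (sens N f T) powr p)"
proof -
  let ?w = "subset_weight N \<delta>"
  have "(\<Sum>S\<in>Pow N. (coef N f S)\<^sup>2 * (real (card S) * (\<delta> * (1 - \<delta>) ^ (card S - 1))))
      = (\<Sum>S\<in>Pow N. (coef N f S)\<^sup>2 * (\<Sum>I\<in>Pow N. ?w I * (\<Sum>i\<in>S. of_bool (I \<inter> S = {i}))))"
  proof (rule sum.cong[OF refl])
    fix S assume S: "S \<in> Pow N"
    have "(\<Sum>I\<in>Pow N. ?w I * (\<Sum>i\<in>S. of_bool (I \<inter> S = {i})))
        = (\<Sum>i\<in>S. \<Sum>I\<in>Pow N. ?w I * of_bool (I \<inter> S = {i}))"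
      unfolding sum_distrib_left by (rule sum.swap)
    also have "\<dots> = real (card S) * (\<delta> * (1 - \<delta>) ^ (card S - 1))"
      using sum_subset_weight_inter[OF N] S by (subst sum.cong[OF refl]) auto
    finally show "(coef N f S)\<^sup>2 * (real (card S) * (\<delta> * (1 - \<delta>) ^ (card S - 1)))
        = (coef N f S)\<^sup>2 * (\<Sum>I\<in>Pow N. ?w I * (\<Sum>i\<in>S. of_bool (I \<inter> S = {i})))"
      by simp
  qed
  also have "\<dots> = (\<Sum>I\<in>Pow N. ?w I * (\<Sum>S\<in>Pow N. (coef N f S)\<^sup>2 * (\<Sum>i\<in>S. of_bool (I \<inter> S = {i}))))"
    by (rule sum_mult_sum_swap)
  also have "\<dots> \<le> (\<Sum>I\<in>Pow N. ?w I * avg N (\<lambda>T. real (sens I f T) powr p))"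
    using assms by (intro sum_mono mult_left_mono avg_sens_powr_ge subset_weight_nonneg) auto
  also have "\<dots> = avg N (\<lambda>T. \<Sum>I\<in>Pow N. ?w I * real (sens I f T) powr p)"
    by (simp add: avg_sum avg_mult_left)
  also have "\<dots> \<le> avg N (\<lambda>T. \<delta> powr p * real (sens N f T) powr p)"
    using assms by (intro avg_mono sum_subset_weight_sens_le) auto
  finally show ?thesis by (simp add: avg_mult_left)
qed

text \<open>Integrates \<open>noise_derivative_le\<close>: the derivative of the left-hand side is
  at most \<open>\<delta> powr (p - 1) * A\<close>. Hence \<open>\<Phi>\<close>, which is 0 at 0,
  does not increase.\<close>

theorem noise_sensitivity_le:
  assumes N: "finite N" and f: "\<And>T. T \<subseteq> N \<Longrightarrow> f T \<in> {-1, 1}" and p: "1 / 2 \<le> p" "p \<le> 1"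
    and \<delta>: "0 \<le> \<delta>" "\<delta> \<le> 1"
  shows "(\<Sum>S\<in>Pow N. (coef N f S)\<^sup>2 * (1 - (1 - \<delta>) ^ card S))
    \<le> \<delta> powr p / p * avg N (\<lambda>T. real (sens N f T) powr p)"
proof -
  define A where "A = avg N (\<lambda>T. real (sens N f T) powr p)"
  define \<Phi> where "\<Phi> t = (\<Sum>S\<in>Pow N. (coef N f S)\<^sup>2 * (1 - (1 - t) ^ card S)) - t powr p / p * A" for t :: real
  have "\<Phi> 0 \<ge> \<Phi> \<delta>"
  proof (rule DERIV_nonpos_imp_decreasing_open[OF \<delta>(1)])
    fix t assume t: "0 < t" "t < \<delta>"
    define D where "D = (\<Sum>S\<in>Pow N. (coef N f S)\<^sup>2 * (real (card S) * (1 - t) ^ (card S - 1))) - t powr (p - 1) * A"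
    have "DERIV \<Phi> t :> D"
      unfolding \<Phi>_def D_def using t p
      by (auto intro!: derivative_eq_intros sum.cong simp: field_simps)
    moreover have "t * D \<le> 0"
    proof -
      have "t * t powr (p - 1) = t powr p"
        using t by (simp add: powr_diff)
      then have "t * D = (\<Sum>S\<in>Pow N. (coef N f S)\<^sup>2 * (real (card S) * (t * (1 - t) ^ (card S - 1)))) - t powr p * A"
        unfolding D_def right_diff_distrib sum_distrib_left mult.assoc[symmetric] by (simp add: mult_ac)
      then show ?thesis
        using noise_derivative_le[OF N f p, where \<delta> = t] t \<delta> unfolding A_def by auto
    qed
    ultimately show "\<exists>y. DERIV \<Phi> t :> y \<and> y \<le> 0"
      using t by (auto simp: mult_le_0_iff)
  next
    \<comment> \<open>The power may fail to be differentiable at 0, so the end points are covered by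
      continuity.\<close>
    show "continuous_on {0..\<delta>} \<Phi>"
      unfolding \<Phi>_def using p by (intro continuous_intros continuous_on_powr') auto
  qed
  then show ?thesis using p unfolding \<Phi>_def A_def by simp
qed

section \<open>Approximation by juntas\<close>

text \<open>The conditional expectation \<open>m\<close> given the coordinates in \<open>J\<close>
  is rounded to its sign. On a fibre the error is
  \<open>(1 - \<bar>m\<bar>) / 2 \<le> (1 - m^2) / 2\<close>, and the mean of \<open>m^2\<close> is
  the weight inside \<open>J\<close>.\<close>

lemma junta_rounding:
  assumes N: "finite N" and J: "J \<subseteq> N" and f: "\<And>T. T \<subseteq> N \<Longrightarrow> f T \<in> {-1, 1}"
  shows "avg N (\<lambda>T. of_bool (f T \<noteq> (if 0 \<le> avg (N - J) (\<lambda>T1. f (T1 \<union> (T \<inter> J))) then 1 else -1)))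
    \<le> (1 - (\<Sum>S\<in>Pow J. (coef N f S)\<^sup>2)) / 2"
proof -
  define K where "K = N - J"
  have fin: "finite J" "finite K" and KJ: "K \<inter> J = {}" "K \<union> J = N"
    using N J finite_subset by (auto simp: K_def)
  define m where "m T2 = avg K (\<lambda>T1. f (T1 \<union> T2))" for T2
  define s :: "'a set \<Rightarrow> real" where "s T2 = (if 0 \<le> m T2 then 1 else -1)" for T2
  have "avg N (\<lambda>T. of_bool (f T \<noteq> s (T \<inter> J))) = avg J (\<lambda>T2. avg K (\<lambda>T1. of_bool (f (T1 \<union> T2) \<noteq> s ((T1 \<union> T2) \<inter> J))))"
    using avg_Un[OF fin(2,1) KJ(1)] KJ(2) by simp
  also have "\<dots> \<le> avg J (\<lambda>T2. (1 - (m T2)\<^sup>2) / 2)"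
  proof (rule avg_mono)
    fix T2 assume T2: "T2 \<subseteq> J"
    have fT: "f (T1 \<union> T2) = -1 \<or> f (T1 \<union> T2) = 1" if "T1 \<subseteq> K" for T1
      using f[of "T1 \<union> T2"] that T2 KJ by blast
    have TJ: "(T1 \<union> T2) \<inter> J = T2" if "T1 \<subseteq> K" for T1 using that T2 KJ by auto
    have "avg K (\<lambda>T1. of_bool (f (T1 \<union> T2) \<noteq> s ((T1 \<union> T2) \<inter> J))) = avg K (\<lambda>T1. (1 - s T2 * f (T1 \<union> T2)) / 2)"
    proof (rule avg_cong)
      fix T1 assume T1: "T1 \<subseteq> K"
      show "of_bool (f (T1 \<union> T2) \<noteq> s ((T1 \<union> T2) \<inter> J)) = (1 - s T2 * f (T1 \<union> T2)) / 2"
        using fT[OF T1] by (auto simp: TJ[OF T1] s_def)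
    qed
    also have "\<dots> = (1 - s T2 * m T2) / 2"
      using fin by (simp add: avg_divide avg_diff avg_mult_left avg_const m_def)
    also have "\<dots> = (1 - \<bar>m T2\<bar>) / 2" by (simp add: s_def)
    also have "\<dots> \<le> (1 - (m T2)\<^sup>2) / 2"
    proof -
      have "- 1 \<le> f (T1 \<union> T2)" "f (T1 \<union> T2) \<le> 1" if "T1 \<subseteq> K" for T1
        using fT[OF that] by auto
      then have "avg K (\<lambda>T1. f (T1 \<union> T2)) \<le> avg K (\<lambda>T1. 1)" "avg K (\<lambda>T1. -1) \<le> avg K (\<lambda>T1. f (T1 \<union> T2))"
        by (intro avg_mono; blast)+
      then have "\<bar>m T2\<bar> \<le> 1" using fin by (simp add: avg_const m_def)
      then have "\<bar>m T2\<bar> * \<bar>m T2\<bar> \<le> 1 * \<bar>m T2\<bar>" by (intro mult_right_mono) auto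
      then show ?thesis by (simp add: power2_eq_square)
    qed
    finally show "avg K (\<lambda>T1. of_bool (f (T1 \<union> T2) \<noteq> s ((T1 \<union> T2) \<inter> J))) \<le> (1 - (m T2)\<^sup>2) / 2" .
  qed
  also have "\<dots> = (1 - avg J (\<lambda>T2. (m T2)\<^sup>2)) / 2"
    using fin by (simp add: avg_divide avg_diff avg_const)
  also have "avg J (\<lambda>T2. (m T2)\<^sup>2) = (\<Sum>S\<in>Pow J. (coef N f S)\<^sup>2)"
    using avg_coef_restrict_sq[OF fin(2,1) KJ(1), of "{}" f] KJ(2) by (simp add: m_def coef_def)
  finally show ?thesis unfolding s_def m_def K_def .
qed

text \<open>A set not contained in \<open>J\<close> has at least \<open>d\<close> points or is small
  and contains some \<open>i\<close> outside \<open>J\<close>; a union bound over \<open>i\<close>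
  covers the second case.\<close>

lemma junta_weight_split:
  assumes N: "finite N" and J: "J \<subseteq> N" and f: "\<And>T. T \<subseteq> N \<Longrightarrow> f T \<in> {-1, 1}"
  shows "1 - (\<Sum>S\<in>Pow J. (coef N f S)\<^sup>2) \<le> (\<Sum>S\<in>{S \<in> Pow N. d \<le> card S}. (coef N f S)\<^sup>2)
    + (\<Sum>i\<in>N - J. \<Sum>S\<in>{S \<in> Pow N. i \<in> S \<and> card S \<le> d}. (coef N f S)\<^sup>2)"
proof -
  let ?c = "\<lambda>S. (coef N f S)\<^sup>2"
  have eq: "(\<Sum>S\<in>{S \<in> Pow N. P S}. ?c S) = (\<Sum>S\<in>Pow N. of_bool (P S) * ?c S)" for P
    using N by (intro sum.mono_neutral_cong_left) auto
  have "(\<Sum>S\<in>Pow N. ?c S) = (\<Sum>S\<in>Pow N - Pow J. ?c S) + (\<Sum>S\<in>Pow J. ?c S)"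
    using J N by (intro sum.subset_diff) auto
  then have "1 - (\<Sum>S\<in>Pow J. ?c S) = (\<Sum>S\<in>Pow N - Pow J. ?c S)"
    using sum_coef_sq_sign[OF N f] by simp
  also have "\<dots> = (\<Sum>S\<in>Pow N. of_bool (\<not> S \<subseteq> J) * ?c S)"
    using N by (intro sum.mono_neutral_cong_left) auto
  also have "\<dots> \<le> (\<Sum>S\<in>Pow N. of_bool (d \<le> card S) * ?c S + (\<Sum>i\<in>N - J. of_bool (i \<in> S \<and> card S \<le> d) * ?c S))"
  proof (intro sum_mono)
    fix S assume S: "S \<in> Pow N"
    show "of_bool (\<not> S \<subseteq> J) * ?c S \<le> of_bool (d \<le> card S) * ?c S + (\<Sum>i\<in>N - J. of_bool (i \<in> S \<and> card S \<le> d) * ?c S)"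
    proof (cases "d \<le> card S \<or> S \<subseteq> J")
      case True
      have "0 \<le> (\<Sum>i\<in>N - J. of_bool (i \<in> S \<and> card S \<le> d) * ?c S)"
        by (intro sum_nonneg) auto
      with True show ?thesis by (auto simp: of_bool_def)
    next
      case False
      then obtain i where i: "i \<in> S" "i \<in> N - J" using S by auto
      then have "of_bool (i \<in> S \<and> card S \<le> d) * ?c S \<le> (\<Sum>i\<in>N - J. of_bool (i \<in> S \<and> card S \<le> d) * ?c S)"
        using N by (intro member_le_sum) auto
      then show ?thesis using False i by auto
    qed
  qed
  also have "\<dots> = (\<Sum>S\<in>{S \<in> Pow N. d \<le> card S}. ?c S) + (\<Sum>i\<in>N - J. \<Sum>S\<in>{S \<in> Pow N. i \<in> S \<and> card S \<le> d}. ?c S)"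
    unfolding eq sum.distrib by (subst (2) sum.swap) simp
  finally show ?thesis .
qed

text \<open>At noise rate \<open>1 / d\<close>, sets of size at least \<open>d\<close> have damping
  factor at most \<open>exp (- 1) \<le> 1 / 2\<close>, so half of their weight is seen by the noise
  sensitivity. The constant 4 is this 2 times the bound \<open>1 / p \<le> 2\<close>.\<close>

lemma high_degree_weight_le:
  assumes N: "finite N" and f: "\<And>T. T \<subseteq> N \<Longrightarrow> f T \<in> {-1, 1}" and p: "1 / 2 \<le> p" "p \<le> 1" and d: "0 < d"
  shows "(\<Sum>S\<in>{S \<in> Pow N. d \<le> card S}. (coef N f S)\<^sup>2)
    \<le> 4 * real d powr - p * avg N (\<lambda>T. real (sens N f T) powr p)"
proof -
  define A where "A = avg N (\<lambda>T. real (sens N f T) powr p)"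
  have A: "0 \<le> A" unfolding A_def by (intro avg_nonneg) auto
  let ?\<delta> = "1 / real d"
  have \<delta>: "0 \<le> ?\<delta>" "?\<delta> \<le> 1" using d by auto
  have tail: "(1 - ?\<delta>) ^ m \<le> 1 / 2" if "d \<le> m" for m
  proof -
    have "(1 - ?\<delta>) ^ m \<le> (1 - ?\<delta>) ^ d" using that \<delta> by (intro power_decreasing) auto
    also have "\<dots> \<le> (exp (- ?\<delta>)) ^ d"
      using \<delta> exp_ge_add_one_self[of "- ?\<delta>"] by (intro power_mono) auto
    also have "\<dots> = exp (- 1)" using d by (simp flip: exp_of_nat_mult)
    also have "\<dots> = inverse (exp 1)" by (rule exp_minus)
    also have "\<dots> \<le> inverse 2"
      using exp_ge_add_one_self[of 1] by (intro le_imp_inverse_le) auto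
    finally show ?thesis by simp
  qed
  have "(\<Sum>S\<in>{S \<in> Pow N. d \<le> card S}. (coef N f S)\<^sup>2)
      \<le> (\<Sum>S\<in>{S \<in> Pow N. d \<le> card S}. 2 * ((coef N f S)\<^sup>2 * (1 - (1 - ?\<delta>) ^ card S)))"
  proof (rule sum_mono)
    fix S assume "S \<in> {S \<in> Pow N. d \<le> card S}"
    then have "(coef N f S)\<^sup>2 * (1 / 2) \<le> (coef N f S)\<^sup>2 * (1 - (1 - ?\<delta>) ^ card S)"
      using tail[of "card S"] by (intro mult_left_mono) auto
    then show "(coef N f S)\<^sup>2 \<le> 2 * ((coef N f S)\<^sup>2 * (1 - (1 - ?\<delta>) ^ card S))" by simp
  qed
  also have "\<dots> \<le> (\<Sum>S\<in>Pow N. 2 * ((coef N f S)\<^sup>2 * (1 - (1 - ?\<delta>) ^ card S)))"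
    using N \<delta> by (intro sum_mono2) (auto intro!: mult_nonneg_nonneg simp: power_le_one)
  also have "\<dots> = 2 * (\<Sum>S\<in>Pow N. (coef N f S)\<^sup>2 * (1 - (1 - ?\<delta>) ^ card S))"
    by (rule sum_distrib_left[symmetric])
  also have "\<dots> \<le> 2 * (?\<delta> powr p / p * A)"
    unfolding A_def by (intro mult_left_mono noise_sensitivity_le) (use assms \<delta> in auto)
  also have "\<dots> \<le> 2 * (?\<delta> powr p * 2 * A)"
  proof -
    have "1 / p \<le> 2" using p by (simp add: field_simps)
    then have "?\<delta> powr p * (1 / p) \<le> ?\<delta> powr p * 2" by (intro mult_left_mono) auto
    then show ?thesis using A by (intro mult_left_mono mult_right_mono) auto
  qed
  also have "\<dots> = 4 * real d powr - p * A"
    using d by (simp add: powr_divide powr_minus_divide)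
  finally show ?thesis unfolding A_def .
qed

text \<open>The triangle inequality for the norm with exponent \<open>r = 1 / p\<close>, by duality:
  the influences are tested against \<open>v i powr (r - 1)\<close>. Since derivatives are 0 or 1 in
  absolute value, \<open>sens\<close> to the power \<open>p\<close> is the norm of the
  gradient.\<close>

lemma sum_influence_powr_le:
  assumes N: "finite N" and f: "\<And>T. T \<subseteq> N \<Longrightarrow> f T \<in> {-1, 1}" and p: "0 < p" "p \<le> 1"
    and A: "avg N (\<lambda>T. real (sens N f T) powr p) \<le> A"
  shows "(\<Sum>i\<in>N. avg N (\<lambda>T. \<bar>deriv_coord f i T\<bar>) powr (1 / p)) \<le> A powr (1 / p)"
proof -
  define v where "v i = avg N (\<lambda>T. \<bar>deriv_coord f i T\<bar>)" for i
  define r where "r = 1 / p"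
  define M where "M = (\<Sum>i\<in>N. v i powr r)"
  have v: "0 \<le> v i" for i unfolding v_def by (intro avg_nonneg) auto
  have M: "0 \<le> M" unfolding M_def by (intro sum_nonneg) auto
  have r: "1 \<le> r" "r * (1 - p) = r - 1" using p by (auto simp: r_def field_simps)
  have sens: "(\<Sum>i\<in>N. \<bar>deriv_coord f i T\<bar>) = sens N f T" if T: "T \<subseteq> N" for T
  proof -
    have "sym_diff T {i} \<subseteq> N" if "i \<in> N" for i using that T by auto
    then show ?thesis
      unfolding sens_eq_sum[OF N] by (intro sum.cong refl deriv_coord_sign(2) f T)
  qed
  \<comment> \<open>Dividing by \<open>M powr (1 - p)\<close> will give the claim. The case
    \<open>p = 1\<close> is apart because Holder needs a weight below 1; there
    \<open>M powr 0\<close> is 1 unless \<open>M = 0\<close>.\<close>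
  have "M \<le> A * M powr (1 - p)"
  proof (cases "p = 1")
    case True
    have "M = avg N (\<lambda>T. \<Sum>i\<in>N. \<bar>deriv_coord f i T\<bar>)"
      using v True by (simp add: M_def r_def v_def[symmetric] avg_sum)
    also have "\<dots> = avg N (\<lambda>T. real (sens N f T) powr p)"
      using True by (intro avg_cong) (simp add: sens)
    finally show ?thesis using A M True by (cases "M = 0") auto
  next
    case False
    then have p1: "p < 1" using p by simp
    have "M = (\<Sum>i\<in>N. v i * v i powr (r - 1))"
      unfolding M_def
    proof (intro sum.cong refl)
      fix i
      show "v i powr r = v i * v i powr (r - 1)"
        using v[of i] by (cases "v i = 0") (auto simp: powr_diff)
    qed
    also have "\<dots> = avg N (\<lambda>T. \<Sum>i\<in>N. \<bar>deriv_coord f i T\<bar> * v i powr (r - 1))"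
      by (simp add: avg_sum avg_mult_right v_def)
    also have "\<dots> \<le> avg N (\<lambda>T. real (sens N f T) powr p * M powr (1 - p))"
    proof (rule avg_mono)
      fix T assume T: "T \<subseteq> N"
      have "\<bar>deriv_coord f i T\<bar> powr p = \<bar>deriv_coord f i T\<bar>" if "i \<in> N" for i
      proof -
        have "sym_diff T {i} \<subseteq> N" using that T by auto
        then have "deriv_coord f i T \<in> {-1, 0, 1}"
          by (intro deriv_coord_sign(1) f T)
        then show ?thesis by auto
      qed
      then have "(\<Sum>i\<in>N. \<bar>deriv_coord f i T\<bar> * v i powr (r - 1))
          = (\<Sum>i\<in>N. \<bar>deriv_coord f i T\<bar> powr p * (v i powr r) powr (1 - p))"
        by (intro sum.cong refl) (simp add: powr_powr r)
      also have "\<dots> \<le> (\<Sum>i\<in>N. \<bar>deriv_coord f i T\<bar>) powr p * M powr (1 - p)"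
        unfolding M_def using N p p1 by (intro Holder_sum_powr) auto
      finally show "(\<Sum>i\<in>N. \<bar>deriv_coord f i T\<bar> * v i powr (r - 1)) \<le> real (sens N f T) powr p * M powr (1 - p)"
        by (simp add: sens T)
    qed
    also have "\<dots> \<le> A * M powr (1 - p)"
      unfolding avg_mult_right using A by (intro mult_right_mono) auto
    finally show ?thesis .
  qed
  show ?thesis
  proof (cases "M = 0")
    case True
    then show ?thesis unfolding M_def v_def r_def by simp
  next
    case False
    then have M0: "M > 0" using M by simp
    have "M powr p * M powr (1 - p) = M" using M0 by (simp flip: powr_add)
    with \<open>M \<le> A * M powr (1 - p)\<close> have "M powr p * M powr (1 - p) \<le> A * M powr (1 - p)" by simp
    then have "M powr p \<le> A" using M0 by simp
    then have "(M powr p) powr r \<le> A powr r" using r by (intro powr_mono2) auto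
    then show ?thesis using M0 p by (simp add: powr_powr M_def v_def r_def)
  qed
qed

section \<open>Choice of parameters\<close>

text \<open>The moment \<open>2 * k\<close> in the hypercontractive bound needs \<open>2 - 1 / k - 1 / p \<ge> \<eta>\<close>, which \<open>1 / k \<le> \<eta>\<close> ensures.
  The exponent \<open>17\<close> in the base comes from the degree \<open>d = \<lceil>16 X\<rceil> \<le> 17 X\<close>, where
  \<open>X = (A / \<epsilon>) powr (1 / p) \<ge> 1\<close>.\<close>

definition moment_order :: "real \<Rightarrow> nat" where
  "moment_order \<eta> = nat \<lceil>1 / \<eta>\<rceil>"

definition junta_base :: "real \<Rightarrow> real" where
  "junta_base \<eta> = 2 * (4 * (real (moment_order \<eta>))\<^sup>2) ^ 17"

lemma moment_order:
  assumes "0 < \<eta>"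
  shows "0 < moment_order \<eta>" and "1 / real (moment_order \<eta>) \<le> \<eta>"
proof -
  have pos: "0 < 1 / \<eta>" using assms by simp
  then show k: "0 < moment_order \<eta>" by (simp add: moment_order_def)
  have "1 / \<eta> \<le> real (moment_order \<eta>)" unfolding moment_order_def by (rule real_nat_ceiling_ge)
  then show "1 / real (moment_order \<eta>) \<le> \<eta>" using assms k by (simp add: field_simps)
qed

lemma junta_base_ge:
  assumes "0 < \<eta>"
  shows "2 \<le> junta_base \<eta>"
proof -
  have "1 \<le> (real (moment_order \<eta>))\<^sup>2" using moment_order(1)[OF assms] by simp
  then have "1 \<le> 4 * (real (moment_order \<eta>))\<^sup>2" by linarith
  then have "1 \<le> (4 * (real (moment_order \<eta>))\<^sup>2) ^ 17" by (rule one_le_power)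
  then show ?thesis unfolding junta_base_def by linarith
qed

text \<open>The weight missed by the influential coordinates \<open>J\<close> is split at degree
  \<open>d\<close>: noise sensitivity bounds the high part and hypercontractivity the low part, each
  by \<open>\<epsilon>\<close>. The sum of powers of influences bounds the size of
  \<open>J\<close>.\<close>

lemma junta_weight_le:
  assumes N: "finite N" and f: "\<And>T. T \<subseteq> N \<Longrightarrow> f T \<in> {-1, 1}"
    and \<eta>: "0 < \<eta>" and p: "1 / 2 + \<eta> \<le> p" "p \<le> 1" and \<epsilon>: "0 < \<epsilon>" "\<epsilon> < 1" and A: "\<epsilon> < A"
    and sA: "avg N (\<lambda>T. real (sens N f T) powr p) \<le> A"
    and X: "X = (A / \<epsilon>) powr (1 / p)"
    and \<tau>: "\<tau> = junta_base \<eta> powr (- X / \<eta>)"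
    and J: "J = {i \<in> N. \<tau> \<le> avg N (\<lambda>T. \<bar>deriv_coord f i T\<bar>)}"
  shows "1 - (\<Sum>S\<in>Pow J. (coef N f S)\<^sup>2) \<le> 2 * \<epsilon>"
    and "real (card J) \<le> 2 powr X * junta_base \<eta> powr (2 * X / \<eta>)"
proof -
  define v where "v i = avg N (\<lambda>T. \<bar>deriv_coord f i T\<bar>)" for i
  define k where "k = moment_order \<eta>"
  define B where "B = 4 * (real k)\<^sup>2"
  \<comment> \<open>The 16 ensures \<open>16 powr p \<ge> 4\<close>, absorbing the constant of
    \<open>high_degree_weight_le\<close>.\<close>
  define d where "d = nat \<lceil>16 * X\<rceil>"
  have k: "0 < k" "1 / real k \<le> \<eta>" using moment_order[OF \<eta>] by (auto simp: k_def)
  have "(real k)\<^sup>2 \<ge> 1" using k by simp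
  then have B: "B \<ge> 1" unfolding B_def by linarith
  have base: "junta_base \<eta> = 2 * B ^ 17" by (simp add: junta_base_def B_def k_def)
  have base2: "2 \<le> junta_base \<eta>" by (rule junta_base_ge[OF \<eta>])
  have p0: "0 < p" "1 / 2 \<le> p" using p \<eta> by auto
  have ip: "1 \<le> 1 / p" "1 / p \<le> 2" using p0 p by (auto simp: field_simps)
  have A\<epsilon>: "1 \<le> A / \<epsilon>" "0 < A" using A \<epsilon> by (auto simp: field_simps)
  have X1: "1 \<le> X" unfolding X using A\<epsilon> p0 by (intro ge_one_powr_ge_zero) auto
  have Xp: "X powr p = A / \<epsilon>" unfolding X using A\<epsilon> p0 \<epsilon> by (simp add: powr_powr)
  have d: "0 < d" "16 * X \<le> real d" "real d \<le> 17 * X"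
    using X1 unfolding d_def by linarith+
  have X2: "X \<le> 2 powr X"
  proof -
    have "X * (1 / 2) \<le> X * ln 2" using X1 ln2_ge_two_thirds by (intro mult_left_mono) auto
    \<comment> \<open>The difference of the two sides is \<open>(1 - X / 4)^2\<close>.\<close>
    have "X \<le> (1 + X / 4)\<^sup>2"
      using zero_le_power2[of "1 - X / 4"] by (simp add: power2_eq_square algebra_simps)
    also have "\<dots> \<le> (exp (X / 4))\<^sup>2" using X1 by (intro power_mono) auto
    also have "\<dots> = exp (X * (1 / 2))" by (simp flip: exp_double)
    also have "\<dots> \<le> exp (X * ln 2)" using \<open>X * (1 / 2) \<le> X * ln 2\<close> by simp
    finally show ?thesis by (simp add: powr_def)
  qed
  have v: "0 \<le> v i" for i unfolding v_def by (intro avg_nonneg) auto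
  have \<tau>0: "0 < \<tau>" unfolding \<tau> using base2 by simp
  have \<tau>1: "\<tau> \<le> 1" unfolding \<tau> using powr_mono[of "- X / \<eta>" 0 "junta_base \<eta>"] base2 X1 \<eta> by simp
  have sumv: "(\<Sum>i\<in>N. v i powr (1 / p)) \<le> A powr (1 / p)"
    unfolding v_def by (rule sum_influence_powr_le[OF N f p0(1) p(2) sA])
  have AX: "A powr (1 / p) \<le> X * \<epsilon>"
  proof -
    have "A powr (1 / p) = X * \<epsilon> powr (1 / p)"
      unfolding X using A\<epsilon> \<epsilon> by (simp add: powr_divide)
    also have "\<epsilon> powr (1 / p) \<le> \<epsilon> powr 1"
      using \<epsilon> ip by (intro powr_mono') auto
    finally show ?thesis using X1 \<epsilon> by (simp add: mult_left_mono)
  qed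
  have high: "(\<Sum>S\<in>{S \<in> Pow N. d \<le> card S}. (coef N f S)\<^sup>2) \<le> \<epsilon>"
  proof -
    have "4 * (A / \<epsilon>) \<le> 16 powr p * X powr p"
    proof -
      have "4 = (16::real) powr (1 / 2)" by (simp add: powr_half_sqrt)
      also have "\<dots> \<le> 16 powr p" using p0 by (intro powr_mono) auto
      finally show ?thesis unfolding Xp using A\<epsilon> by (intro mult_right_mono) auto
    qed
    also have "\<dots> \<le> real d powr p"
      using d X1 p0 by (simp flip: powr_mult add: powr_mono2)
    finally have "4 * A \<le> \<epsilon> * real d powr p" using \<epsilon> by (simp add: field_simps)
    then have "4 * real d powr - p * A \<le> \<epsilon>"
      using d by (simp add: powr_minus field_simps)
    moreover have "4 * real d powr - p * avg N (\<lambda>T. real (sens N f T) powr p) \<le> 4 * real d powr - p * A"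
      using sA by (intro mult_left_mono) auto
    moreover have "(\<Sum>S\<in>{S \<in> Pow N. d \<le> card S}. (coef N f S)\<^sup>2)
        \<le> 4 * real d powr - p * avg N (\<lambda>T. real (sens N f T) powr p)"
      by (intro high_degree_weight_le N f p0 p d)
    ultimately show ?thesis by linarith
  qed
  have low_i: "(\<Sum>S\<in>{S \<in> Pow N. i \<in> S \<and> card S \<le> d}. (coef N f S)\<^sup>2) \<le> 2 powr - X * v i powr (1 / p)"
    if i: "i \<in> N - J" for i
  proof -
    define e where "e = 2 - 1 / real k - 1 / p"
    \<comment> \<open>From \<open>1 / p \<le> 2 - 2 * \<eta>\<close> and
      \<open>1 / k \<le> \<eta>\<close>. The first uses \<open>2 * \<eta> \<le> 1\<close>, forced by
      \<open>1 / 2 + \<eta> \<le> p \<le> 1\<close>.\<close>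
    have e: "\<eta> \<le> e"
    proof -
      have "1 / p \<le> 1 / (1 / 2 + \<eta>)" using p \<eta> by (intro divide_left_mono) auto
      moreover have "1 / (1 / 2 + \<eta>) \<le> 2 - 2 * \<eta>"
      proof -
        have "0 \<le> \<eta> * (1 - 2 * \<eta>)" using \<eta> p by (intro mult_nonneg_nonneg) auto
        then have "1 \<le> (2 - 2 * \<eta>) * (1 / 2 + \<eta>)" by (simp add: algebra_simps)
        then show ?thesis using \<eta> by (simp add: divide_le_eq)
      qed
      ultimately show ?thesis using k unfolding e_def by linarith
    qed
    have vt: "v i < \<tau>" using i by (auto simp: J v_def)
    have der: "deriv_coord f i T \<in> {-1, 0, 1}" if T: "T \<subseteq> N" for T
    proof -
      have "sym_diff T {i} \<subseteq> N" using T i by auto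
      then show ?thesis by (intro deriv_coord_sign(1) f T)
    qed
    \<comment> \<open>On sets containing \<open>i\<close>, \<open>f\<close> and its derivative share
      coefficients, but the derivative has mean absolute value \<open>v i < \<tau>\<close>, so
      hypercontractivity gains.\<close>
    have "(\<Sum>S\<in>{S \<in> Pow N. i \<in> S \<and> card S \<le> d}. (coef N f S)\<^sup>2)
        = (\<Sum>S\<in>{S \<in> Pow N. i \<in> S \<and> card S \<le> d}. (coef N (deriv_coord f i) S)\<^sup>2)"
      using N by (intro sum.cong refl) (auto simp: coef_deriv_coord)
    also have "\<dots> \<le> B ^ d * v i powr (2 - 1 / real k)"
      unfolding B_def v_def by (rule low_degree_weight_le[OF N k(1)]) (use der in auto)
    also have "v i powr (2 - 1 / real k) = v i powr e * v i powr (1 / p)"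
      by (simp add: e_def flip: powr_add)
    also have "B ^ d * (v i powr e * v i powr (1 / p)) \<le> B powr (17 * X) * (\<tau> powr \<eta> * v i powr (1 / p))"
    proof (intro mult_mono mult_right_mono)
      have "B ^ d = B powr real d" using B by (simp add: powr_realpow)
      also have "\<dots> \<le> B powr (17 * X)" using B d by (intro powr_mono) auto
      finally show "B ^ d \<le> B powr (17 * X)" .
      have "v i powr e \<le> \<tau> powr e" using vt v e \<eta> by (intro powr_mono2) auto
      also have "\<dots> \<le> \<tau> powr \<eta>" using \<tau>0 \<tau>1 e by (intro powr_mono') auto
      finally show "v i powr e \<le> \<tau> powr \<eta>" .
    qed auto
    also have "\<dots> = (B powr (17 * X) * \<tau> powr \<eta>) * v i powr (1 / p)" by simp
    \<comment> \<open>\<open>\<tau>\<close> is chosen for this: \<open>\<tau> powr \<eta>\<close>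
      cancels the hypercontractive loss and leaves \<open>2 powr - X\<close> to beat the factor
      \<open>X\<close> in \<open>AX\<close>.\<close>
    also have "B powr (17 * X) * \<tau> powr \<eta> = 2 powr - X"
    proof -
      have "\<tau> powr \<eta> = (2 * B ^ 17) powr (- X)"
        unfolding \<tau> base using \<eta> by (simp add: powr_powr)
      also have "\<dots> = 2 powr - X * (B powr 17) powr - X"
        using B by (simp add: powr_mult powr_numeral)
      finally have "\<tau> powr \<eta> = 2 powr - X * B powr (- (17 * X))"
        by (simp add: powr_powr)
      then show ?thesis using B by (simp add: powr_minus)
    qed
    finally show ?thesis .
  qed
  have "(\<Sum>i\<in>N - J. \<Sum>S\<in>{S \<in> Pow N. i \<in> S \<and> card S \<le> d}. (coef N f S)\<^sup>2)
      \<le> (\<Sum>i\<in>N - J. 2 powr - X * v i powr (1 / p))"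
    by (rule sum_mono[OF low_i])
  also have "\<dots> \<le> (\<Sum>i\<in>N. 2 powr - X * v i powr (1 / p))"
    using N by (intro sum_mono2) auto
  also have "\<dots> \<le> 2 powr - X * (X * \<epsilon>)"
    unfolding sum_distrib_left[symmetric] using sumv AX by (intro mult_left_mono) auto
  also have "\<dots> \<le> 2 powr - X * (2 powr X * \<epsilon>)"
    using X2 \<epsilon> by (intro mult_left_mono mult_right_mono) auto
  also have "\<dots> = \<epsilon>" by (simp add: powr_minus)
  finally have low: "(\<Sum>i\<in>N - J. \<Sum>S\<in>{S \<in> Pow N. i \<in> S \<and> card S \<le> d}. (coef N f S)\<^sup>2) \<le> \<epsilon>" .
  have JN: "J \<subseteq> N" by (auto simp: J)
  show "1 - (\<Sum>S\<in>Pow J. (coef N f S)\<^sup>2) \<le> 2 * \<epsilon>"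
    by (rule order_trans[OF junta_weight_split[where d = d]]) (use N JN f high low in auto)
  show "real (card J) \<le> 2 powr X * junta_base \<eta> powr (2 * X / \<eta>)"
  proof -
    \<comment> \<open>A Markov-type count: each \<open>i \<in> J\<close> contributes at least
      \<open>\<tau> powr 2\<close>, as \<open>\<tau> \<le> 1\<close> and
      \<open>1 / p \<le> 2\<close>.\<close>
    have "real (card J) * \<tau> powr 2 \<le> (\<Sum>i\<in>J. v i powr (1 / p))"
    proof -
      have "(\<Sum>i\<in>J. \<tau> powr 2) \<le> (\<Sum>i\<in>J. v i powr (1 / p))"
      proof (rule sum_mono)
        fix i assume "i \<in> J"
        have "\<tau> powr 2 \<le> \<tau> powr (1 / p)" using \<tau>0 \<tau>1 ip by (intro powr_mono') auto
        also have "\<dots> \<le> v i powr (1 / p)"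
          using \<open>i \<in> J\<close> \<tau>0 p0 unfolding J v_def by (intro powr_mono2) auto
        finally show "\<tau> powr 2 \<le> v i powr (1 / p)" .
      qed
      then show ?thesis by simp
    qed
    also have "\<dots> \<le> (\<Sum>i\<in>N. v i powr (1 / p))" using N JN by (intro sum_mono2) auto
    also have "\<dots> \<le> X * \<epsilon>" using sumv AX by linarith
    also have "\<dots> \<le> X * 1" using X1 \<epsilon> by (intro mult_left_mono) auto
    also have "\<dots> \<le> 2 powr X" using X2 by simp
    finally have c: "real (card J) * \<tau> powr 2 \<le> 2 powr X" .
    have t: "\<tau> powr 2 * junta_base \<eta> powr (2 * X / \<eta>) = 1"
      unfolding \<tau> powr_powr powr_add[symmetric] using base2 by simp
    have "real (card J) = real (card J) * \<tau> powr 2 * junta_base \<eta> powr (2 * X / \<eta>)"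
      using t by (simp add: mult.assoc)
    also have "\<dots> \<le> 2 powr X * junta_base \<eta> powr (2 * X / \<eta>)"
      using c by (intro mult_right_mono) auto
    finally show ?thesis .
  qed
qed

text \<open>Times \<open>X\<close>, this is the base-2 logarithm of the size bound in
  \<open>junta_weight_le\<close>.\<close>

definition junta_const :: "real \<Rightarrow> real" where
  "junta_const \<eta> = 1 + 2 * log 2 (junta_base \<eta>) / \<eta>"

text \<open>If \<open>\<epsilon> \<ge> 1\<close> or \<open>A \<le> \<epsilon>\<close>, the empty set
  works; otherwise \<open>junta_weight_le\<close> applies. The target is
  \<open>2 * \<epsilon>\<close> because rounding halves the missing weight.\<close>

lemma ex_junta_support:
  assumes N: "finite N" and f: "\<And>T. T \<subseteq> N \<Longrightarrow> f T \<in> {-1, 1}"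
    and \<eta>: "0 < \<eta>" and p: "1 / 2 + \<eta> \<le> p" "p \<le> 1" and \<epsilon>: "0 < \<epsilon>"
    and sA: "avg N (\<lambda>T. real (sens N f T) powr p) \<le> A"
  obtains J where "J \<subseteq> N" and "real (card J) \<le> 2 powr (junta_const \<eta> * (A / \<epsilon>) powr (1 / p))"
    and "1 - (\<Sum>S\<in>Pow J. (coef N f S)\<^sup>2) \<le> 2 * \<epsilon>"
proof (cases "1 \<le> \<epsilon> \<or> A \<le> \<epsilon>")
  case True
  have "1 - (\<Sum>S\<in>Pow {}. (coef N f S)\<^sup>2) \<le> 2 * \<epsilon>"
  proof (cases "A \<le> \<epsilon>")
    case True
    have "1 - (coef N f {})\<^sup>2 = (\<Sum>S\<in>Pow N - {{}}. (coef N f S)\<^sup>2)"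
      using sum_coef_sq_sign[OF N f] N by (simp add: sum_diff1)
    \<comment> \<open>The variance is the noise sensitivity at rate 1, since
      \<open>0 ^ card S\<close> is 1 only for the empty set.\<close>
    also have "\<dots> = (\<Sum>S\<in>Pow N. (coef N f S)\<^sup>2 * (1 - (1 - 1) ^ card S))"
      using N by (intro sum.mono_neutral_cong_left) (auto simp: card_gt_0_iff finite_subset power_0_left)
    also have "\<dots> \<le> 1 powr p / p * avg N (\<lambda>T. real (sens N f T) powr p)"
      using p \<eta> by (intro noise_sensitivity_le N f) auto
    also have "\<dots> \<le> 2 * \<epsilon>"
    proof (rule mult_mono)
      show "1 powr p / p \<le> 2" using p \<eta> by (simp add: field_simps)
    qed (use sA True p \<eta> in \<open>auto intro: avg_nonneg\<close>)
    finally show ?thesis by simp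
  next
    case False
    then have "1 \<le> \<epsilon>" using \<open>1 \<le> \<epsilon> \<or> A \<le> \<epsilon>\<close> by simp
    moreover have "0 \<le> (coef N f {})\<^sup>2" by simp
    ultimately have "1 - (coef N f {})\<^sup>2 \<le> 2 * \<epsilon>" by linarith
    then show ?thesis by simp
  qed
  then show ?thesis by (intro that[of "{}"]) auto
next
  case False
  define X where "X = (A / \<epsilon>) powr (1 / p)"
  define J where "J = {i \<in> N. junta_base \<eta> powr (- X / \<eta>) \<le> avg N (\<lambda>T. \<bar>deriv_coord f i T\<bar>)}"
  have w: "1 - (\<Sum>S\<in>Pow J. (coef N f S)\<^sup>2) \<le> 2 * \<epsilon>"
    "real (card J) \<le> 2 powr X * junta_base \<eta> powr (2 * X / \<eta>)"
    using junta_weight_le[OF N f \<eta> p \<epsilon> _ _ sA X_def refl J_def] False by auto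
  have "junta_base \<eta> powr (2 * X / \<eta>) = 2 powr (log 2 (junta_base \<eta>) * (2 * X / \<eta>))"
    unfolding powr_powr[symmetric] using junta_base_ge[OF \<eta>] by simp
  then have "2 powr X * junta_base \<eta> powr (2 * X / \<eta>) = 2 powr (junta_const \<eta> * X)"
    by (simp add: junta_const_def algebra_simps flip: powr_add)
  with w show ?thesis by (intro that[of J]) (auto simp: J_def X_def)
qed

section \<open>Transfer between points of the cube and subsets, and the final theorem\<close>

definition cube_point :: "nat \<Rightarrow> nat set \<Rightarrow> nat \<Rightarrow> bool" where
  "cube_point n T = restrict (\<lambda>i. i \<in> T) {1..n}"

lemma bij_betw_cube_point: "bij_betw (cube_point n) (Pow {1..n}) (cube n)"
  by (rule bij_betw_byWitness[where f' = "\<lambda>x. {i \<in> {1..n}. x i}"])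
    (auto simp: cube_point_def cube_def PiE_iff extensional_def fun_eq_iff)

lemma card_cube: "card (cube n) = 2 ^ n"
  using bij_betw_same_card[OF bij_betw_cube_point, of n] by (simp add: card_Pow)

lemma expectation_uniform_cube:
  "measure_pmf.expectation (uniform_cube n) g = avg {1..n} (\<lambda>T. g (cube_point n T))"
  using sum.reindex_bij_betw[OF bij_betw_cube_point, of g n]
  by (simp add: uniform_cube_def avg_def integral_pmf_of_set[OF cube_nonempty finite_cube] card_cube)

lemma prob_uniform_cube:
  "measure_pmf.prob (uniform_cube n) {x. P x} = avg {1..n} (\<lambda>T. of_bool (P (cube_point n T)))"
proof -
  have "measure_pmf.prob (uniform_cube n) {x. P x}
      = measure_pmf.expectation (uniform_cube n) (indicator {x. P x})"
    by simp
  also have "(indicator {x. P x} :: _ \<Rightarrow> real) = (\<lambda>x. of_bool (P x))"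
    by (auto simp: indicator_def)
  finally show ?thesis unfolding expectation_uniform_cube .
qed

lemma flip_bit_cube_point:
  "i \<in> {1..n} \<Longrightarrow> flip_bit (cube_point n T) i = cube_point n (sym_diff T {i})"
  by (auto simp: flip_bit_def cube_point_def fun_eq_iff)

theorem theorem1p5:
  fixes \<eta> :: real
  assumes "\<eta> > 0"
  shows "\<exists>C::real. C > 0 \<and>
    (\<forall>(\<epsilon>::real) (A::real) (p::real) (n::nat) (f :: (nat \<Rightarrow> bool) \<Rightarrow> bool).
       \<epsilon> > 0 \<longrightarrow> A > 0 \<longrightarrow> 1/2 + \<eta> \<le> p \<longrightarrow> p \<le> 1 \<longrightarrow> n > 0 \<longrightarrow>
       measure_pmf.expectation (uniform_cube n) (\<lambda>x. real (sensitivity n f x) powr p) \<le> A \<longrightarrow>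
       close_to_junta n \<epsilon> (2 powr (C * (A / \<epsilon>) powr (1 / p))) f)"
proof (intro exI[of _ "junta_const \<eta>"] conjI allI impI)
  have "0 \<le> log 2 (junta_base \<eta>)" using junta_base_ge[OF assms] by simp
  then have "0 \<le> 2 * log 2 (junta_base \<eta>) / \<eta>" using assms by simp
  then show "0 < junta_const \<eta>" unfolding junta_const_def by linarith
next
  fix \<epsilon> A p :: real and n :: nat and f :: "(nat \<Rightarrow> bool) \<Rightarrow> bool"
  assume \<epsilon>: "\<epsilon> > 0" and p: "1/2 + \<eta> \<le> p" "p \<le> 1"
    and sA: "measure_pmf.expectation (uniform_cube n) (\<lambda>x. real (sensitivity n f x) powr p) \<le> A"
  define N where "N = {1..n}"
  define F :: "nat set \<Rightarrow> real" where "F T = (if f (cube_point n T) then 1 else -1)" for T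
  have N: "finite N" by (simp add: N_def)
  have F: "F T \<in> {-1, 1}" for T by (simp add: F_def)
  have "sensitivity n f (cube_point n T) = sens N F T" for T
    unfolding sensitivity_def sens_def N_def
    by (intro arg_cong[where f = card]) (auto simp: flip_bit_cube_point F_def)
  then have "avg N (\<lambda>T. real (sens N F T) powr p) \<le> A"
    using sA by (simp add: expectation_uniform_cube N_def)
  then obtain J where J: "J \<subseteq> N" "real (card J) \<le> 2 powr (junta_const \<eta> * (A / \<epsilon>) powr (1 / p))"
    "1 - (\<Sum>S\<in>Pow J. (coef N F S)\<^sup>2) \<le> 2 * \<epsilon>"
    by (rule ex_junta_support[where f = F, OF N F assms p \<epsilon>])
  \<comment> \<open>The Boolean form of the sign in \<open>junta_rounding\<close>. It reads only
    coordinates in \<open>J\<close>, so it serves both as the junta and as its function on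
    restrictions.\<close>
  define h where "h y \<longleftrightarrow> 0 \<le> avg (N - J) (\<lambda>T1. F (T1 \<union> {i \<in> J. y i}))" for y
  have "is_junta n (2 powr (junta_const \<eta> * (A / \<epsilon>) powr (1 / p))) h"
    unfolding is_junta_def
  proof (intro exI[of _ J] exI[of _ h] conjI ballI)
    fix x
    have "{i \<in> J. restrict x J i} = {i \<in> J. x i}" by auto
    then show "h x = h (restrict x J)" by (simp add: h_def)
  qed (use J N_def in auto)
  moreover have "measure_pmf.prob (uniform_cube n) {x. f x \<noteq> h x} \<le> \<epsilon>"
  proof -
    have "measure_pmf.prob (uniform_cube n) {x. f x \<noteq> h x}
        = avg N (\<lambda>T. of_bool (F T \<noteq> (if 0 \<le> avg (N - J) (\<lambda>T1. F (T1 \<union> (T \<inter> J))) then 1 else -1)))"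
      unfolding prob_uniform_cube N_def[symmetric]
    proof (rule avg_cong)
      fix T
      have "{i \<in> J. cube_point n T i} = T \<inter> J"
        using J(1) by (auto simp: cube_point_def N_def)
      then show "of_bool (f (cube_point n T) \<noteq> h (cube_point n T))
          = of_bool (F T \<noteq> (if 0 \<le> avg (N - J) (\<lambda>T1. F (T1 \<union> (T \<inter> J))) then 1 else -1))"
        by (simp add: h_def F_def[of T])
    qed
    also have "\<dots> \<le> (1 - (\<Sum>S\<in>Pow J. (coef N F S)\<^sup>2)) / 2"
      by (rule junta_rounding[where f = F, OF N J(1) F])
    finally show ?thesis using J(3) by simp
  qed
  ultimately show "close_to_junta n \<epsilon> (2 powr (junta_const \<eta> * (A / \<epsilon>) powr (1 / p))) f"
    unfolding close_to_junta_def by blast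
qed

end
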